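(* In the setting of the context ($D,p_1,\dots,p_D,S$ fixed, $J=O(1)$, $n\to\infty$), suppose that all of the following hold, with constants independent of $n$. (a) For every $s=1,\dots,S$ the quasi-true parameter $\mathcal{B}^*_{(s)}=\llbracket \mathbf{B}^*_{(s),1},\dots,\mathbf{B}^*_{(s),D}\rrbracket$ exists, belongs to a compact space $\mathbb{B}$, and satisfies $\|\boldsymbol{\beta}_{\widehat{\mathcal{B}}_{(s)}}-\boldsymbol{\beta}_{\mathcal{B}^*_{(s)}}\|=O_p(n^{-1/2})$. Moreover every $\mathcal{B}^*_{(s)}$ and the true parameter $\mathcal{B}_0$ lie in the interior of $\mathbb{B}$. (b) There is a constant $c_0<\infty$ with $\sup_{\mathcal{B}\in\mathbb{B}}\max_{1\le i\le n}\left\|\partial\theta_i\{\mathcal{B}\}/\partial\boldsymbol{\beta}_{\mathcal{B}}\right\|\le c_0$. (c) There are constants $c_1,c_2\in(0,\infty)$ with $\|\boldsymbol{\mu}\|^2/n\le c_1$ and $\max_{1\le i\le n}\|\mathrm{vec}(\mathcal{X}_i)\|\le c_2$. (d) There are constants $0<c_{\min}$ and $c_{\max}<\infty$ such that, as $n\to\infty$, $c_{\min}\le\lambda_{\min}\{\frac1n\sum_{i=1}^n\mathrm{vec}(\mathcal{X}_i)\mathrm{vec}(\mathcal{X}_i)^{\mathrm T}\}$ and $\lambda_{\max}\{\frac1n\sum_{i=1}^n\mathrm{vec}(\mathcal{X}_i)\mathrm{vec}(\mathcal{X}_i)^{\mathrm T}\}\le c_{\max}$, where $\lambda_{\min},\lambda_{\max}$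 denote the smallest and largest eigenvalues. (e) There are constants $c_3<\infty$ and $c_4>0$ with $\sup_{\mathcal{B}\in\mathbb{B}}\max_{1\le i\le n}|b^{(k)}(\theta_i\{\mathcal{B}\})|\le c_3$ for $k=1,2$ ($b^{(k)}$ being the $k$-th derivative), and $\inf_{\mathcal{B}\in\mathbb{B}}\min_{1\le i\le n}b''(\theta_i\{\mathcal{B}\})\ge c_4$. (f) $n\,\xi_n^{-2}=o(1)$, where $\xi_n=\inf_{\mathbf{w}\in\mathcal{W}}\mathrm{KL}^*(\mathbf{w})$. Then $$\frac{\mathrm{KL}(\widehat{\mathbf{w}})}{\inf_{\mathbf{w}\in\mathcal{W}}\mathrm{KL}(\mathbf{w})}\to 1$$ in probability as $n\to\infty$.
   Context: **Tensors.** $\mathrm{vec}(\cdot)$ stacks the entries of a tensor into a column vector, $\langle\mathcal{X},\mathcal{B}\rangle=\mathrm{vec}(\mathcal{X})^{\mathrm T}\mathrm{vec}(\mathcal{B})$, and $\|\cdot\|$ is the Euclidean norm. For matrices $\mathbf{B}_d=[\boldsymbol{\beta}_d^{(1)},\dots,\boldsymbol{\beta}_d^{(R)}]\in\mathbb{R}^{p_d\times R}$, $d=1,\dots,D$, put $\llbracket\mathbf{B}_1,\dots,\mathbf{B}_D\rrbracket=\sum_{r=1}^R\boldsymbol{\beta}_1^{(r)}\circ\cdots\circ\boldsymbol{\beta}_D^{(r)}\in\mathbb{R}^{p_1\times\cdots\times p_D}$, where $\circ$ is the outer product. The (CP) rank of a tensor is the smallest $R$ for which it can be so written. A tensor $\mathcal{B}\in\mathbb{B}$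 is considered together with its CP factors, $\mathcal{B}=\llbracket\mathbf{B}_1,\dots,\mathbf{B}_D\rrbracket$ (with a fixed common number of columns, factorizations with fewer columns being padded with zero columns), and $\boldsymbol{\beta}_{\mathcal{B}}$ is the vector stacking all entries of $\mathbf{B}_1,\dots,\mathbf{B}_D$. **Data and true model.** For each $n$ there are independent observations $(y_i,\mathcal{X}_i)$, $i=1,\dots,n$, with $\mathcal{X}_i\in\mathbb{R}^{p_1\times\cdots\times p_D}$; the covariates are treated as given (expectations are over the responses). For a tensor $\mathcal{B}$ let $\theta_i\{\mathcal{B}\}=\langle\mathcal{B},\mathcal{X}_i\rangle$. The response $y_i$ has exponential-family density (or mass function) $\Pr(y\mid\theta,\phi)=\exp\{(y\theta-b(\theta))/\phi+c(y,\phi)\}$ with $\theta=\theta_{0i}=\langle\mathcal{B}_0,\mathcal{X}_i\rangle$, where $b,c$ are known functions, $\phi>0$ is the dispersion parameter and $\mathcal{B}_0$ is the true parameter. Write $\mathbf{y}=(y_1,\dots,y_n)^{\mathrm T}$ and $\boldsymbol{\mu}=(\mu_1,\dots,\mu_n)^{\mathrm T}=\mathbb{E}(\mathbf{y})$. **Candidate models.** There are $S$ candidate models with ranks $r_1<\cdots<r_S$. The estimator of the $s$-th model, $\widehat{\mathcal{B}}_{(s)}=\llbracket\widehat{\mathbf{B}}_{(s),1},\dots,\widehat{\mathbf{B}}_{(s),D}\rrbracket$, is the maximum likelihood estimator, maximizing $\sum_{i=1}^n\{y_i\langle\mathcal{B},\mathcal{X}_i\rangle-b(\langle\mathcal{B},\mathcal{X}_i\rangle)\}/\phi$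 over $\mathcal{B}=\llbracket\mathbf{B}_1,\dots,\mathbf{B}_D\rrbracket$ with $\mathbf{B}_d\in\mathbb{R}^{p_d\times r_s}$, the factors being subject to constraints that remove the scale and permutation indeterminacy of the decomposition; the factors are then padded with zero columns to have $r_S$ columns. The quasi-true parameter $\mathcal{B}^*_{(s)}$ is the parameter of the $s$-th candidate model (a CP form with $r_s$ terms) that minimizes the Kullback–Leibler loss between the $s$-th candidate model and the true model; it equals $\mathcal{B}_0$ if the $s$-th model is correctly specified. **Averaging.** $\mathcal{W}=\{\mathbf{w}\in[0,1]^S:\sum_{s=1}^Sw_s=1\}$, $\widehat{\mathcal{B}}(\mathbf{w})=\sum_{s=1}^Sw_s\widehat{\mathcal{B}}_{(s)}$, $\mathcal{B}^*(\mathbf{w})=\sum_{s=1}^Sw_s\mathcal{B}^*_{(s)}$. The KL loss is $$\mathrm{KL}(\mathbf{w})=2\phi^{-1}\sum_{i=1}^n\Big[b(\theta_i\{\widehat{\mathcal{B}}(\mathbf{w})\})-\mu_i\theta_i\{\widehat{\mathcal{B}}(\mathbf{w})\}-b(\theta_{0i})+\mu_i\theta_{0i}\Big],$$ which equals $2\,\mathbb{E}_{\mathbf{y}^*}\log\frac{\prod_i\Pr(y_i^*\mid\theta_{0i},\phi)}{\prod_i\Pr(y_i^*\mid\theta_i\{\widehat{\mathcal{B}}(\mathbf{w})\},\phi)}$ with $\mathbf{y}^*$ an independent copy of $\mathbf{y}$. $\mathrm{KL}^*(\mathbf{w})$ is the same expression with $\widehat{\mathcal{B}}(\mathbf{w})$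 replaced by $\mathcal{B}^*(\mathbf{w})$. **Weights by $J$-fold cross-validation.** Assume $n_0=n/J$ is an integer. The $j$-th fold consists of observations $(j-1)n_0+i$, $i=1,\dots,n_0$, denoted $(y_{j,i},\mathcal{X}_{j,i})$. Let $\widehat{\mathcal{B}}^{[-j]}_{(s)}$ be the estimator of the $s$-th model computed without the $j$-th fold, and $\widehat{\mathcal{B}}^{[-j]}(\mathbf{w})=\sum_{s=1}^Sw_s\widehat{\mathcal{B}}^{[-j]}_{(s)}$. Define $$\mathrm{CV}_J(\mathbf{w})=2\phi^{-1}\sum_{j=1}^J\sum_{i=1}^{n_0}\Big[b\big(\langle\widehat{\mathcal{B}}^{[-j]}(\mathbf{w}),\mathcal{X}_{j,i}\rangle\big)-y_{j,i}\langle\widehat{\mathcal{B}}^{[-j]}(\mathbf{w}),\mathcal{X}_{j,i}\rangle\Big],$$ and $\widehat{\mathbf{w}}=\operatorname{argmin}_{\mathbf{w}\in\mathcal{W}}\mathrm{CV}_J(\mathbf{w})$.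
   Formalization: The rate in (a) is also assumed for the estimators computed without the j-th fold (maximum over j, around the same quasi-true parameters, J at least 2); with given covariates and the full-data rate alone the claim can fail when the folds have very different designs. *)

theory Defs
  imports
    "HOL-Probability.Probability"
    "HOL-Combinatorics.Permutations"
    "Jordan_Normal_Form.Spectral_Radius"
begin

section \<open>Tensors and CP factors\<close>

text \<open>
  A tensor of size \<open>p 0 \<times> \<dots> \<times> p (D - 1)\<close> is a function of multi-indices \<open>i \<in> (\<Pi>\<^sub>E d\<in>{..<D}. {..<p d})\<close>;
  its values elsewhere are never used.
\<close>

type_synonym tensor = "(nat \<Rightarrow> nat) \<Rightarrow> real"

text \<open>
  CP factors: \<open>F d k c\<close> is the \<open>(k, c)\<close> entry of the \<open>d\<close>-th factor matrix.  Entries outside the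
  range are zero, so factors with \<open>R'\<close> columns are literally the factors with \<open>R \<ge> R'\<close> columns
  whose last \<open>R - R'\<close> columns vanish, and no explicit padding operation is needed.
\<close>

type_synonym factors = "nat \<Rightarrow> nat \<Rightarrow> nat \<Rightarrow> real"

definition factor_space :: "nat \<Rightarrow> (nat \<Rightarrow> nat) \<Rightarrow> nat \<Rightarrow> factors set" where
  "factor_space D p R = {F. \<forall>d k c. \<not> (d < D \<and> k < p d \<and> c < R) \<longrightarrow> F d k c = 0}"

text \<open>The \<open>k\<close>-th multi-index when the first index varies fastest (column-major order).\<close>

definition multi_index :: "nat \<Rightarrow> (nat \<Rightarrow> nat) \<Rightarrow> nat \<Rightarrow> nat \<Rightarrow> nat" where
  "multi_index D p k = (\<lambda>d\<in>{..<D}. (k div (\<Prod>e<d. p e)) mod p d)"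

definition tvec :: "nat \<Rightarrow> (nat \<Rightarrow> nat) \<Rightarrow> tensor \<Rightarrow> real Matrix.vec" where
  "tvec D p T = Matrix.vec (\<Prod>d<D. p d) (\<lambda>k. T (multi_index D p k))"

definition tinner :: "nat \<Rightarrow> (nat \<Rightarrow> nat) \<Rightarrow> tensor \<Rightarrow> tensor \<Rightarrow> real" where
  "tinner D p T U = scalar_prod (tvec D p T) (tvec D p U)"

definition tnorm :: "nat \<Rightarrow> (nat \<Rightarrow> nat) \<Rightarrow> tensor \<Rightarrow> real" where
  "tnorm D p T = sqrt (scalar_prod (tvec D p T) (tvec D p T))"

definition outer_prod :: "nat \<Rightarrow> (nat \<Rightarrow> nat \<Rightarrow> real) \<Rightarrow> tensor" where
  "outer_prod D v = (\<lambda>i. \<Prod>d<D. v d (i d))"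

definition cp :: "nat \<Rightarrow> nat \<Rightarrow> factors \<Rightarrow> tensor" where
  "cp D R F = (\<lambda>i. \<Sum>c<R. outer_prod D (\<lambda>d k. F d k c) i)"

text \<open>Euclidean distance of the stacked factor entries.\<close>

definition factor_dist :: "nat \<Rightarrow> (nat \<Rightarrow> nat) \<Rightarrow> nat \<Rightarrow> factors \<Rightarrow> factors \<Rightarrow> real" where
  "factor_dist D p R F G = sqrt (\<Sum>d<D. \<Sum>k<p d. \<Sum>c<R. (F d k c - G d k c)\<^sup>2)"

definition partial_deriv :: "(factors \<Rightarrow> real) \<Rightarrow> factors \<Rightarrow> nat \<Rightarrow> nat \<Rightarrow> nat \<Rightarrow> real" where
  "partial_deriv f F d k c =
     deriv (\<lambda>t. f (F(d := (F d)(k := (F d k)(c := t))))) (F d k c)"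

definition grad_norm :: "nat \<Rightarrow> (nat \<Rightarrow> nat) \<Rightarrow> nat \<Rightarrow> (factors \<Rightarrow> real) \<Rightarrow> factors \<Rightarrow> real" where
  "grad_norm D p R f F = sqrt (\<Sum>d<D. \<Sum>k<p d. \<Sum>c<R. (partial_deriv f F d k c)\<^sup>2)"

text \<open>
  Two factorizations with \<open>R\<close> columns that differ only by a permutation of the rank-one terms and
  by rescalings of the vectors within each term, and a constraint set that contains
  at most one factorization of each such class.
\<close>

definition cp_indeterminate ::
  "nat \<Rightarrow> (nat \<Rightarrow> nat) \<Rightarrow> nat \<Rightarrow> factors \<Rightarrow> factors \<Rightarrow> bool" where
  "cp_indeterminate D p R F G \<longleftrightarrow>
     (\<exists>\<pi> a. \<pi> permutes {..<R} \<and> (\<forall>c<R. (\<Prod>d<D. a d c) = (1::real)) \<and>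
        (\<forall>d<D. \<forall>k<p d. \<forall>c<R. G d k c = a d c * F d k (\<pi> c)))"

definition removes_indeterminacy ::
  "nat \<Rightarrow> (nat \<Rightarrow> nat) \<Rightarrow> nat \<Rightarrow> factors set \<Rightarrow> bool" where
  "removes_indeterminacy D p R C \<longleftrightarrow>
     C \<subseteq> factor_space D p R \<and>
     (\<forall>F\<in>C. \<forall>G\<in>C. cp_indeterminate D p R F G \<longrightarrow> F = G)"

text \<open>The matrix \<open>(1/n) \<Sum>\<^sub>i vec(X\<^sub>i) vec(X\<^sub>i)\<^sup>T\<close>.\<close>

definition gram_mat :: "nat \<Rightarrow> (nat \<Rightarrow> nat) \<Rightarrow> nat \<Rightarrow> (nat \<Rightarrow> tensor) \<Rightarrow> real Matrix.mat" where
  "gram_mat D p n X = Matrix.mat (\<Prod>d<D. p d) (\<Prod>d<D. p d)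
     (\<lambda>(k, l). (\<Sum>i=1..n. vec_index (tvec D p (X i)) k * vec_index (tvec D p (X i)) l) / real n)"

definition lambda_min :: "real Matrix.mat \<Rightarrow> real" where
  "lambda_min A = Min (spectrum A)"

definition lambda_max :: "real Matrix.mat \<Rightarrow> real" where
  "lambda_max A = Max (spectrum A)"


section \<open>Exponential families\<close>

definition expfam_density ::
  "(real \<Rightarrow> real) \<Rightarrow> (real \<Rightarrow> real \<Rightarrow> real) \<Rightarrow> real \<Rightarrow> real \<Rightarrow> real \<Rightarrow> real" where
  "expfam_density b c \<phi> \<theta> y = exp ((y * \<theta> - b \<theta>) / \<phi> + c y \<phi>)"

text \<open>
  The dominating measure \<open>\<nu>\<close> is Lebesgue measure, a counting measure, or a restriction of these to
  the common support of the family.  The natural parameter ranges over an open interval \<open>\<Theta>\<close>, which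
  is the whole line for the normal, binomial and Poisson families and a half-line for the gamma
  family; outside \<open>\<Theta>\<close> the values of \<open>b\<close> have no meaning.
\<close>

definition exp_family ::
  "real measure \<Rightarrow> (real \<Rightarrow> real) \<Rightarrow> (real \<Rightarrow> real \<Rightarrow> real) \<Rightarrow> real \<Rightarrow> real set \<Rightarrow> bool" where
  "exp_family \<nu> b c \<phi> \<Theta> \<longleftrightarrow>
     sigma_finite_measure \<nu> \<and> sets \<nu> = sets borel \<and> (\<lambda>y. c y \<phi>) \<in> borel_measurable borel \<and>
     open \<Theta> \<and> is_interval \<Theta> \<and>
     (\<forall>\<theta>\<in>\<Theta>. (\<integral>\<^sup>+ y. ennreal (expfam_density b c \<phi> \<theta> y) \<partial>\<nu>) = 1)"


section \<open>Estimation, losses and model averaging\<close>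

text \<open>
  \<open>\<eta> i\<close> stands for the natural parameter of the \<open>i\<close>-th observation under the tensor considered.
\<close>

definition lin_pred :: "nat \<Rightarrow> (nat \<Rightarrow> nat) \<Rightarrow> (nat \<Rightarrow> tensor) \<Rightarrow> tensor \<Rightarrow> nat \<Rightarrow> real" where
  "lin_pred D p X T i = tinner D p T (X i)"

definition log_lik ::
  "(real \<Rightarrow> real) \<Rightarrow> real \<Rightarrow> nat set \<Rightarrow> (nat \<Rightarrow> real) \<Rightarrow> (nat \<Rightarrow> real) \<Rightarrow> real" where
  "log_lik b \<phi> A y \<eta> = (\<Sum>i\<in>A. y i * \<eta> i - b (\<eta> i)) / \<phi>"

definition KL_loss ::
  "(real \<Rightarrow> real) \<Rightarrow> real \<Rightarrow> nat \<Rightarrow> (nat \<Rightarrow> real) \<Rightarrow> (nat \<Rightarrow> real) \<Rightarrow> (nat \<Rightarrow> real) \<Rightarrow> real" where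
  "KL_loss b \<phi> n \<mu> \<eta>0 \<eta> =
     2 / \<phi> * (\<Sum>i=1..n. b (\<eta> i) - \<mu> i * \<eta> i - b (\<eta>0 i) + \<mu> i * \<eta>0 i)"

text \<open>
  The parameters of a candidate model with constraint set \<open>C\<close>: all \<open>n\<close> natural parameters have to
  be admissible, which is no restriction if \<open>\<Theta> = UNIV\<close>.
\<close>

definition cand_params ::
  "nat \<Rightarrow> (nat \<Rightarrow> nat) \<Rightarrow> nat \<Rightarrow> real set \<Rightarrow> nat \<Rightarrow> (nat \<Rightarrow> tensor) \<Rightarrow> factors set \<Rightarrow> factors set"
where
  "cand_params D p R \<Theta> n X C = {F \<in> C. \<forall>i\<in>{1..n}. lin_pred D p X (cp D R F) i \<in> \<Theta>}"

text \<open>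
  Maximum likelihood from the observations in \<open>A\<close>.  In discrete models the likelihood may, with
  positive probability, have no maximizer (e.g. separation in logistic regression); the estimate is
  then an arbitrary parameter of the model.
\<close>

definition is_MLE ::
  "(factors \<Rightarrow> nat \<Rightarrow> real) \<Rightarrow> (real \<Rightarrow> real) \<Rightarrow> real \<Rightarrow> nat set \<Rightarrow> (nat \<Rightarrow> real) \<Rightarrow>
   factors set \<Rightarrow> factors \<Rightarrow> bool" where
  "is_MLE \<eta> b \<phi> A y P F \<longleftrightarrow>
     F \<in> P \<and>
     ((\<exists>G. is_arg_max (\<lambda>H. log_lik b \<phi> A y (\<eta> H)) (\<lambda>H. H \<in> P) G) \<longrightarrow>
      is_arg_max (\<lambda>H. log_lik b \<phi> A y (\<eta> H)) (\<lambda>H. H \<in> P) F)"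

definition weight_simplex :: "nat \<Rightarrow> (nat \<Rightarrow> real) set" where
  "weight_simplex S = {w. (\<forall>s\<in>{1..S}. 0 \<le> w s \<and> w s \<le> 1) \<and> (\<Sum>s=1..S. w s) = 1}"

definition tavg :: "nat \<Rightarrow> (nat \<Rightarrow> real) \<Rightarrow> (nat \<Rightarrow> tensor) \<Rightarrow> tensor" where
  "tavg S w T = (\<lambda>i. \<Sum>s=1..S. w s * T s i)"

text \<open>The \<open>j\<close>-th of \<open>J\<close> folds of \<open>{1..n}\<close>, for \<open>j \<in> {1..J}\<close> and \<open>J\<close> dividing \<open>n\<close>.\<close>

definition cv_fold :: "nat \<Rightarrow> nat \<Rightarrow> nat \<Rightarrow> nat set" where
  "cv_fold n J j = (\<lambda>i. (j - 1) * (n div J) + i) ` {1..n div J}"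

text \<open>\<open>\<eta> j\<close> is computed from the estimates without the \<open>j\<close>-th fold.\<close>

definition CV_crit ::
  "(real \<Rightarrow> real) \<Rightarrow> real \<Rightarrow> nat \<Rightarrow> nat \<Rightarrow> (nat \<Rightarrow> real) \<Rightarrow> (nat \<Rightarrow> nat \<Rightarrow> real) \<Rightarrow> real" where
  "CV_crit b \<phi> n J y \<eta> = 2 / \<phi> * (\<Sum>j=1..J. \<Sum>i\<in>cv_fold n J j. b (\<eta> j i) - y i * \<eta> j i)"


section \<open>Stochastic asymptotics\<close>

text \<open>
  \<open>n \<rightarrow> \<infinity>\<close> along a set of sample sizes: \<open>n\<close> has to be a multiple of the number of folds, which for
  bounded numbers of folds cannot hold for all \<open>n\<close>.
\<close>

definition along :: "nat set \<Rightarrow> nat filter" where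
  "along N = inf sequentially (principal N)"

text \<open>
  \<open>Z n\<close> is meant to be a random variable on \<open>M n\<close>: non-measurable sets have \<open>measure\<close> zero.  Quantities
  built from measurable estimators and weights and a function \<open>b\<close> continuous on \<open>\<Theta>\<close> qualify.
\<close>

definition bigO_prob ::
  "nat filter \<Rightarrow> (nat \<Rightarrow> 'a measure) \<Rightarrow> (nat \<Rightarrow> 'a \<Rightarrow> real) \<Rightarrow> (nat \<Rightarrow> real) \<Rightarrow> bool" where
  "bigO_prob \<F> M Z r \<longleftrightarrow>
     (\<forall>\<epsilon>>0. \<exists>K. \<forall>\<^sub>F n in \<F>. measure (M n) {\<omega> \<in> space (M n). \<bar>Z n \<omega>\<bar> > K * r n} < \<epsilon>)"

definition tendsto_prob ::
  "nat filter \<Rightarrow> (nat \<Rightarrow> 'a measure) \<Rightarrow> (nat \<Rightarrow> 'a \<Rightarrow> real) \<Rightarrow> real \<Rightarrow> bool" where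
  "tendsto_prob \<F> M Z l \<longleftrightarrow>
     (\<forall>\<epsilon>>0. ((\<lambda>n. measure (M n) {\<omega> \<in> space (M n). \<bar>Z n \<omega> - l\<bar> > \<epsilon>}) \<longlongrightarrow> 0) \<F>)"

end

theory Submission
  imports Defs
begin

text \<open>
  The rate conditions make all natural parameters of the averaged estimators, with and without a
  fold, differ from those of the averaged quasi-true parameters by \<open>O\<^sub>p(n\<^sup>-\<^sup>1\<^sup>/\<^sup>2)\<close>, uniformly in the
  weights and the observations.  Since \<open>b\<close> is Lipschitz near the parameters in question, the KL loss
  and, up to a term free of the weights, the cross-validation criterion differ from \<open>KL\<^sup>*\<close> by
  \<open>O\<^sub>p(\<surd>n)\<close>, the noise entering through \<open>\<Sum>\<^sub>i (y\<^sub>i - \<mu>\<^sub>i) \<theta>\<^sub>i\<close>, which has variance \<open>O(n)\<close>.  As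
  \<open>\<surd>n = o(\<xi>\<^sub>n)\<close>, both errors are negligible relative to the infimum of the loss.

  The regularity conditions bound \<open>b'\<close> only at the parameters of \<open>\<BB>\<close>, whereas averages need not come
  from \<open>\<BB>\<close> and estimates may leave it.  Convexity of \<open>b\<close> extends the bound to the convex hull of
  these parameters, and openness of \<open>\<Theta>\<close> to a neighbourhood of the hull within \<open>\<Theta>\<close>.
\<close>

section \<open>Moments of exponential families\<close>

lemma power_div_fact_le_exp:
  fixes z :: real
  assumes "0 \<le> z"
  shows "z ^ k / fact k \<le> exp z"
proof -
  have s: "(\<lambda>n. z ^ n / fact n) sums exp z"
    using exp_converges[of z] by (simp add: divide_inverse mult.commute)
  have "(\<Sum>n\<in>{k}. z ^ n / fact n) \<le> suminf (\<lambda>n. z ^ n / fact n)"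
    using assms s by (intro sum_le_suminf) (auto simp: sums_iff)
  then show ?thesis using s by (simp add: sums_iff)
qed

lemma exp_abs_le: "exp \<bar>x\<bar> \<le> exp x + exp (- x)" for x :: real
  by (cases "0 \<le> x") auto

text \<open>The function \<open>exp (t * x) + exp (- t * x)\<close> dominates
  \<open>exp \<bar>t * x\<bar>\<close>, hence every power of \<open>x\<close> up to a constant and
  all partial sums of the absolute exponential series. Moments therefore exist, and the series for
  \<open>exp (h * x)\<close> may be integrated term by term.\<close>

lemma
  fixes Q :: "real measure"
  assumes sets: "sets Q = sets borel" and \<delta>: "0 < \<delta>"
    and int: "\<And>h. \<bar>h\<bar> < \<delta> \<Longrightarrow> integrable Q (\<lambda>x. exp (h * x))"
  shows integrable_power_mgf: "integrable Q (\<lambda>x. x ^ k)"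
    and mgf_sums: "\<bar>h\<bar> < \<delta> \<Longrightarrow>
      (\<lambda>k. (\<integral>x. x ^ k \<partial>Q) / fact k * h ^ k) sums (\<integral>x. exp (h * x) \<partial>Q)"
proof -
  note [measurable_cong] = sets
  define G where "G t x = exp (t * x) + exp (- t * x)" for t x :: real
  have G: "integrable Q (G t)" if "\<bar>t\<bar> < \<delta>" for t
    unfolding G_def using int[of t] int[of "- t"] that by (intro Bochner_Integration.integrable_add) auto
  have le_G: "exp \<bar>t * x\<bar> \<le> G t x" for t x
    unfolding G_def using exp_abs_le[of "t * x"] by simp
  show pow: "integrable Q (\<lambda>x. x ^ k)" for k
  proof -
    define t where "t = \<delta> / 2"
    have t: "0 < t" "\<bar>t\<bar> < \<delta>" using \<delta> by (auto simp: t_def)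
    have "\<bar>x ^ k\<bar> \<le> fact k / t ^ k * G t x" for x
    proof -
      have "(t * \<bar>x\<bar>) ^ k / fact k \<le> G t x"
        using power_div_fact_le_exp[of "t * \<bar>x\<bar>" k] le_G[of t x] t by (simp add: abs_mult)
      then have "t ^ k * \<bar>x\<bar> ^ k \<le> fact k * G t x"
        by (simp add: power_mult_distrib field_simps)
      then show ?thesis using t by (simp add: power_abs field_simps)
    qed
    then have bound: "norm (x ^ k) \<le> norm (fact k / t ^ k * G t x)" for x
      using abs_ge_self order_trans unfolding real_norm_def by blast
    show ?thesis
    proof (rule Bochner_Integration.integrable_bound)
      show "integrable Q (\<lambda>x. fact k / t ^ k * G t x)"
        using G[OF t(2)] by (rule integrable_mult_right)
      show "AE x in Q. norm (x ^ k) \<le> norm (fact k / t ^ k * G t x)"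
        using bound by (rule AE_I2)
    qed measurable
  qed
  assume h: "\<bar>h\<bar> < \<delta>"
  let ?f = "\<lambda>k x. x ^ k / fact k * h ^ k"
  have s: "(\<lambda>k. ?f k x) sums exp (h * x)" for x
    using exp_converges[of "h * x"] by (simp add: divide_inverse power_mult_distrib mult_ac)
  have sn: "(\<lambda>k. norm (?f k x)) sums exp \<bar>h * x\<bar>" for x
    using exp_converges[of "\<bar>h * x\<bar>"]
    by (simp add: divide_inverse power_mult_distrib mult_ac abs_mult power_abs)
  have int_f: "integrable Q (?f k)" for k
    using pow[of k] by simp
  have "(\<lambda>k. integral\<^sup>L Q (?f k)) sums (\<integral>x. (\<Sum>k. ?f k x) \<partial>Q)"
  proof (rule sums_integral)
    show "AE x in Q. summable (\<lambda>k. norm (?f k x))"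
      using sn by (auto simp: sums_iff)
    show "summable (\<lambda>k. \<integral>x. norm (?f k x) \<partial>Q)"
    proof (rule summableI_nonneg_bounded)
      fix n
      have "(\<Sum>k<n. \<integral>x. norm (?f k x) \<partial>Q) = (\<integral>x. (\<Sum>k<n. norm (?f k x)) \<partial>Q)"
        by (rule Bochner_Integration.integral_sum[symmetric]) (intro integrable_norm int_f)
      also have "\<dots> \<le> (\<integral>x. G h x \<partial>Q)"
      proof (rule integral_mono)
        show "integrable Q (\<lambda>x. \<Sum>k<n. norm (?f k x))"
          by (intro Bochner_Integration.integrable_sum integrable_norm int_f)
        show "(\<Sum>k<n. norm (?f k x)) \<le> G h x" for x
        proof -
          have "(\<Sum>k<n. norm (?f k x)) \<le> (\<Sum>k. norm (?f k x))"
            using sn[of x] by (intro sum_le_suminf) (auto simp: sums_iff)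
          also have "\<dots> = exp \<bar>h * x\<bar>" using sn[of x] by (simp add: sums_iff)
          finally show ?thesis using le_G[of h x] by simp
        qed
      qed (use G h in auto)
      finally show "(\<Sum>k<n. \<integral>x. norm (?f k x) \<partial>Q) \<le> (\<integral>x. G h x \<partial>Q)" .
    qed auto
  qed (rule int_f)
  also have "(\<lambda>x. \<Sum>k. ?f k x) = (\<lambda>x. exp (h * x))"
    using s by (auto simp: sums_iff)
  finally show "(\<lambda>k. (\<integral>x. x ^ k \<partial>Q) / fact k * h ^ k) sums (\<integral>x. exp (h * x) \<partial>Q)"
    by simp
qed

text \<open>By the expansion just proved, the moment generating function \<open>m\<close> is a power
  series near 0 and can be differentiated twice term by term. As \<open>m 0 = 1\<close>, the
  derivative of \<open>m1 / m\<close> at 0 is \<open>m2 0 - (m1 0)\<^sup>2\<close>, the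
  variance.\<close>

lemma cumulant_generating_function:
  fixes Q :: "real measure"
  assumes "prob_space Q" and sets: "sets Q = sets borel" and \<delta>: "0 < \<delta>"
    and int: "\<And>h. \<bar>h\<bar> < \<delta> \<Longrightarrow> integrable Q (\<lambda>x. exp (h * x))"
  defines "L \<equiv> \<lambda>h. ln (\<integral>x. exp (h * x) \<partial>Q)"
  obtains L' where "\<And>h. \<bar>h\<bar> < \<delta> \<Longrightarrow> (L has_real_derivative L' h) (at h)"
    and "L' 0 = (\<integral>x. x \<partial>Q)"
    and "(L' has_real_derivative (\<integral>x. (x - (\<integral>x. x \<partial>Q))\<^sup>2 \<partial>Q)) (at 0)"
proof -
  interpret prob_space Q by fact
  define c where "c k = (\<integral>x. x ^ k \<partial>Q) / fact k" for k
  define m where "m h = (\<integral>x. exp (h * x) \<partial>Q)" for h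
  define m1 where "m1 h = (\<Sum>k. diffs c k * h ^ k)" for h
  define m2 where "m2 h = (\<Sum>k. diffs (diffs c) k * h ^ k)" for h
  note pow = integrable_power_mgf[OF sets \<delta> int, simplified]
  have s: "(\<lambda>k. c k * h ^ k) sums m h" if "\<bar>h\<bar> < \<delta>" for h
    using mgf_sums[OF sets \<delta> int that] by (simp add: c_def m_def)
  have s1: "summable (\<lambda>k. diffs c k * h ^ k)" if "norm h < \<delta>" for h
    using that s by (intro termdiff_converges[of h \<delta>]) (auto simp: sums_iff)
  have open_ball: "open {h. \<bar>h\<bar> < \<delta>}"
    by (simp add: open_Collect_less continuous_intros)
  have D0: "(m has_real_derivative m1 h) (at h)" if "\<bar>h\<bar> < \<delta>" for h
  proof -
    have "((\<lambda>h. \<Sum>k. c k * h ^ k) has_real_derivative m1 h) (at h)"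
      unfolding m1_def using that s by (intro termdiffs_strong'[where K = \<delta>]) (auto simp: sums_iff)
    then show ?thesis
      by (rule has_field_derivative_transform_within_open[OF _ open_ball])
         (use that s in \<open>auto simp: sums_iff\<close>)
  qed
  have D1: "(m1 has_real_derivative m2 h) (at h)" if "\<bar>h\<bar> < \<delta>" for h
    unfolding m1_def m2_def using that s1 by (intro termdiffs_strong'[where K = \<delta>]) auto
  \<comment> \<open>Needed to differentiate the logarithm: a vanishing integral would make an
    exponential zero almost everywhere, which is impossible under a probability measure.\<close>
  have pos: "m h > 0" if "\<bar>h\<bar> < \<delta>" for h
  proof -
    have "m h \<noteq> 0"
      unfolding m_def using integral_nonneg_eq_0_iff_AE[OF int[OF that]] AE_False by auto
    moreover have "m h \<ge> 0" unfolding m_def by simp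
    ultimately show ?thesis by simp
  qed
  have m0: "m 0 = 1" by (simp add: m_def prob_space)
  \<comment> \<open>At the centre only the zeroth coefficient survives; \<open>diffs\<close> has
    moved the first moment (for \<open>m2\<close>, the second) into that place, and the factorial
    cancels.\<close>
  have m10: "m1 0 = (\<integral>x. x \<partial>Q)"
    using suminf_finite[of "{0}" "\<lambda>k. diffs c k * 0 ^ k"]
    by (simp add: m1_def diffs_def c_def)
  have m20: "m2 0 = (\<integral>x. x\<^sup>2 \<partial>Q)"
    using suminf_finite[of "{0}" "\<lambda>k. diffs (diffs c) k * 0 ^ k"]
    by (simp add: m2_def diffs_def c_def numeral_2_eq_2)
  have "(\<integral>x. (x - (\<integral>x. x \<partial>Q))\<^sup>2 \<partial>Q) = m2 0 - (m1 0)\<^sup>2"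
    unfolding m10 m20 using pow[of 1] pow[of 2] by (intro variance_eq) auto
  moreover have "((\<lambda>h. m1 h / m h) has_real_derivative (m2 0 - (m1 0)\<^sup>2)) (at 0)"
    using \<delta> m0 by (auto intro!: derivative_eq_intros D0 D1 simp: power2_eq_square)
  moreover have "(L has_real_derivative m1 h / m h) (at h)" if "\<bar>h\<bar> < \<delta>" for h
    unfolding L_def m_def[symmetric] using D0[OF that] pos[OF that]
    by (auto intro!: derivative_eq_intros)
  ultimately show ?thesis
    using that[of "\<lambda>h. m1 h / m h"] m0 m10 by simp
qed

definition expfam_dist ::
  "real measure \<Rightarrow> (real \<Rightarrow> real) \<Rightarrow> (real \<Rightarrow> real \<Rightarrow> real) \<Rightarrow> real \<Rightarrow> real \<Rightarrow> real measure" where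
  "expfam_dist \<nu> b c \<phi> \<theta> = density \<nu> (\<lambda>y. ennreal (expfam_density b c \<phi> \<theta> y))"

lemma sets_expfam_dist: "exp_family \<nu> b c \<phi> \<Theta> \<Longrightarrow> sets (expfam_dist \<nu> b c \<phi> \<theta>) = sets borel"
  by (simp add: expfam_dist_def exp_family_def)

lemma measurable_expfam_density:
  assumes "exp_family \<nu> b c \<phi> \<Theta>"
  shows "expfam_density b c \<phi> \<theta> \<in> borel_measurable \<nu>"
proof -
  have [measurable_cong]: "sets \<nu> = sets borel" and [measurable]: "(\<lambda>y. c y \<phi>) \<in> borel_measurable borel"
    using assms by (auto simp: exp_family_def)
  show ?thesis unfolding expfam_density_def[abs_def] by measurable
qed

lemma prob_space_expfam_dist:
  assumes "exp_family \<nu> b c \<phi> \<Theta>" "\<theta> \<in> \<Theta>"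
  shows "prob_space (expfam_dist \<nu> b c \<phi> \<theta>)"
proof
  have [measurable]: "expfam_density b c \<phi> \<theta> \<in> borel_measurable \<nu>"
    by (rule measurable_expfam_density[OF assms(1)])
  show "emeasure (expfam_dist \<nu> b c \<phi> \<theta>) (space (expfam_dist \<nu> b c \<phi> \<theta>)) = 1"
    unfolding expfam_dist_def space_density
    by (subst emeasure_density) (use assms in \<open>auto simp: exp_family_def cong: nn_integral_cong\<close>)
qed

text \<open>Tilting the density by \<open>exp (h * y)\<close> gives, up to the constant
  \<open>C\<close>, the member of the family with parameter \<open>\<theta> + \<phi> * h\<close>,
  whose total mass is one.\<close>

lemma expfam_mgf:
  assumes fam: "exp_family \<nu> b c \<phi> \<Theta>" and \<phi>: "\<phi> > 0" and \<theta>: "\<theta> + \<phi> * h \<in> \<Theta>"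
  shows "integrable (expfam_dist \<nu> b c \<phi> \<theta>) (\<lambda>y. exp (h * y))"
    and "(\<integral>y. exp (h * y) \<partial>expfam_dist \<nu> b c \<phi> \<theta>) = exp ((b (\<theta> + \<phi> * h) - b \<theta>) / \<phi>)"
proof -
  have [measurable]: "expfam_density b c \<phi> t \<in> borel_measurable \<nu>" for t
    by (rule measurable_expfam_density[OF fam])
  have [measurable_cong]: "sets \<nu> = sets borel"
    using fam by (simp add: exp_family_def)
  define C where "C = exp ((b (\<theta> + \<phi> * h) - b \<theta>) / \<phi>)"
  have eq: "expfam_density b c \<phi> \<theta> y * exp (h * y) = C * expfam_density b c \<phi> (\<theta> + \<phi> * h) y" for y
    using \<phi> by (simp add: expfam_density_def C_def mult_exp_exp) (simp add: field_simps)
  have C0: "0 \<le> C" by (simp add: C_def)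
  have "(\<integral>\<^sup>+y. ennreal (exp (h * y)) \<partial>expfam_dist \<nu> b c \<phi> \<theta>)
      = (\<integral>\<^sup>+y. ennreal C * ennreal (expfam_density b c \<phi> (\<theta> + \<phi> * h) y) \<partial>\<nu>)"
    unfolding expfam_dist_def
    by (subst nn_integral_density)
       (auto intro!: nn_integral_cong simp: ennreal_mult''[symmetric] ennreal_mult'[symmetric] C0 eq)
  also have "\<dots> = ennreal C"
    using fam \<theta> by (simp add: nn_integral_cmult exp_family_def)
  finally have "integrable (expfam_dist \<nu> b c \<phi> \<theta>) (\<lambda>y. exp (h * y))
      \<and> (\<integral>y. exp (h * y) \<partial>expfam_dist \<nu> b c \<phi> \<theta>) = C"
    by (subst (asm) nn_integral_eq_integrable) (auto simp: C_def expfam_dist_def)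
  then show "integrable (expfam_dist \<nu> b c \<phi> \<theta>) (\<lambda>y. exp (h * y))"
    "(\<integral>y. exp (h * y) \<partial>expfam_dist \<nu> b c \<phi> \<theta>) = exp ((b (\<theta> + \<phi> * h) - b \<theta>) / \<phi>)"
    by (auto simp: C_def)
qed

text \<open>Openness of \<open>\<Theta>\<close> makes the moment generating function finite near 0.
  Solving its formula for \<open>b\<close> shows \<open>b\<close> near \<open>\<theta>\<close> as a
  rescaled cumulant generating function, so the smoothness of \<open>b\<close> is a consequence of
  normalization.\<close>

lemma expfam_moments:
  assumes fam: "exp_family \<nu> b c \<phi> \<Theta>" and \<phi>: "\<phi> > 0" and \<theta>: "\<theta> \<in> \<Theta>"
  defines "Q \<equiv> expfam_dist \<nu> b c \<phi> \<theta>"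
  shows "integrable Q (\<lambda>x. x ^ k)"
    and "(\<integral>x. x \<partial>Q) = deriv b \<theta>"
    and "(\<integral>x. (x - deriv b \<theta>)\<^sup>2 \<partial>Q) = \<phi> * (deriv ^^ 2) b \<theta>"
proof -
  interpret Q: prob_space Q
    unfolding Q_def by (rule prob_space_expfam_dist[OF fam \<theta>])
  have sets: "sets Q = sets borel"
    unfolding Q_def by (rule sets_expfam_dist[OF fam])
  have "open \<Theta>" using fam by (simp add: exp_family_def)
  then obtain \<delta> where \<delta>: "\<delta> > 0" "ball \<theta> \<delta> \<subseteq> \<Theta>"
    using \<theta> open_contains_ball by blast
  have mem: "\<theta> + \<phi> * h \<in> \<Theta>" if "\<bar>h\<bar> < \<delta> / \<phi>" for h
  proof -
    have "\<bar>\<phi> * h\<bar> < \<delta>" using that \<phi> by (simp add: abs_mult field_simps)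
    then show ?thesis using \<delta>(2) by (auto simp: dist_real_def)
  qed
  have \<delta>\<phi>: "0 < \<delta> / \<phi>" using \<delta> \<phi> by simp
  have int: "integrable Q (\<lambda>x. exp (h * x))" if "\<bar>h\<bar> < \<delta> / \<phi>" for h
    unfolding Q_def by (rule expfam_mgf[OF fam \<phi> mem[OF that]])
  show "integrable Q (\<lambda>x. x ^ k)"
    by (rule integrable_power_mgf[OF sets \<delta>\<phi> int])
  define L where "L h = ln (\<integral>x. exp (h * x) \<partial>Q)" for h
  obtain L' where L': "\<And>h. \<bar>h\<bar> < \<delta> / \<phi> \<Longrightarrow> (L has_real_derivative L' h) (at h)"
      "L' 0 = (\<integral>x. x \<partial>Q)"
      "(L' has_real_derivative (\<integral>x. (x - (\<integral>x. x \<partial>Q))\<^sup>2 \<partial>Q)) (at 0)"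
    using cumulant_generating_function[OF Q.prob_space_axioms sets \<delta>\<phi> int]
    unfolding L_def[abs_def] by blast
  have b_eq: "b t = b \<theta> + \<phi> * L ((t - \<theta>) / \<phi>)" if "t \<in> ball \<theta> \<delta>" for t
  proof -
    have "\<bar>(t - \<theta>) / \<phi>\<bar> < \<delta> / \<phi>"
      using that \<phi> by (simp add: dist_real_def divide_strict_right_mono)
    from expfam_mgf(2)[OF fam \<phi> mem[OF this]] show ?thesis
      using \<phi> by (simp add: L_def Q_def)
  qed
  have D_arg: "((\<lambda>t. (t - \<theta>) / \<phi>) has_real_derivative 1 / \<phi>) (at t)" for t
    using \<phi> by (auto intro!: derivative_eq_intros)
  have Db: "(b has_real_derivative L' ((t - \<theta>) / \<phi>)) (at t)" if t: "t \<in> ball \<theta> \<delta>" for t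
  proof -
    have *: "\<bar>(t - \<theta>) / \<phi>\<bar> < \<delta> / \<phi>"
      using t \<phi> by (simp add: dist_real_def divide_strict_right_mono)
    have "((\<lambda>t. b \<theta> + \<phi> * L ((t - \<theta>) / \<phi>)) has_real_derivative
        0 + \<phi> * (L' ((t - \<theta>) / \<phi>) * (1 / \<phi>))) (at t)"
      by (intro DERIV_add DERIV_const DERIV_cmult DERIV_chain2[where f = L and g = "\<lambda>t. (t - \<theta>) / \<phi>"] L'(1)[OF *] D_arg)
    then have "((\<lambda>t. b \<theta> + \<phi> * L ((t - \<theta>) / \<phi>)) has_real_derivative L' ((t - \<theta>) / \<phi>)) (at t)"
      using \<phi> by simp
    then show ?thesis
      by (rule has_field_derivative_transform_within_open[of _ _ _ "ball \<theta> \<delta>"]) (use t b_eq in auto)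
  qed
  \<comment> \<open>The formula holds on a whole ball, so it can be differentiated once more at its
    centre.\<close>
  have deriv_b: "deriv b t = L' ((t - \<theta>) / \<phi>)" if "t \<in> ball \<theta> \<delta>" for t
    using Db[OF that] by (rule DERIV_imp_deriv)
  have \<theta>_ball: "\<theta> \<in> ball \<theta> \<delta>" using \<delta> by simp
  show mean: "(\<integral>x. x \<partial>Q) = deriv b \<theta>"
    using deriv_b[OF \<theta>_ball] L'(2) by simp
  have "((\<lambda>t. L' ((t - \<theta>) / \<phi>)) has_real_derivative
      (\<integral>x. (x - (\<integral>x. x \<partial>Q))\<^sup>2 \<partial>Q) / \<phi>) (at \<theta>)"
    using DERIV_chain2[where f = L' and g = "\<lambda>t. (t - \<theta>) / \<phi>" and x = \<theta>, OF _ D_arg] L'(3) by simp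
  then have "(deriv b has_real_derivative (\<integral>x. (x - (\<integral>x. x \<partial>Q))\<^sup>2 \<partial>Q) / \<phi>) (at \<theta>)"
    by (rule has_field_derivative_transform_within_open[of _ _ _ "ball \<theta> \<delta>"])
       (use \<delta> deriv_b in auto)
  then have "deriv (deriv b) \<theta> = (\<integral>x. (x - deriv b \<theta>)\<^sup>2 \<partial>Q) / \<phi>"
    by (simp add: DERIV_imp_deriv mean)
  then show "(\<integral>x. (x - deriv b \<theta>)\<^sup>2 \<partial>Q) = \<phi> * (deriv ^^ 2) b \<theta>"
    using \<phi> by (simp add: numeral_2_eq_2)
qed

text \<open>Integrating \<open>1 + z \<le> exp z\<close> at
  \<open>z = h * (x - deriv b \<theta>)\<close> under the law with parameter \<open>\<theta>\<close>
  compares 1 with the exponential of the gap divided by \<open>\<phi>\<close>. This convexity of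
  \<open>b\<close> yields both the Lipschitz bounds and the nonnegativity of the KL loss.\<close>

lemma expfam_tangent_le:
  assumes fam: "exp_family \<nu> b c \<phi> \<Theta>" and \<phi>: "\<phi> > 0" and \<theta>: "\<theta> \<in> \<Theta>" "\<theta>' \<in> \<Theta>"
  shows "b \<theta> + deriv b \<theta> * (\<theta>' - \<theta>) \<le> b \<theta>'"
proof -
  define Q where "Q = expfam_dist \<nu> b c \<phi> \<theta>"
  define h where "h = (\<theta>' - \<theta>) / \<phi>"
  interpret Q: prob_space Q
    unfolding Q_def by (rule prob_space_expfam_dist[OF fam \<theta>(1)])
  have h: "\<theta> + \<phi> * h = \<theta>'" using \<phi> by (simp add: h_def)
  have int: "integrable Q (\<lambda>x. exp (h * x))" "(\<integral>x. exp (h * x) \<partial>Q) = exp ((b \<theta>' - b \<theta>) / \<phi>)"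
    using expfam_mgf[OF fam \<phi>, of \<theta> h] \<theta>(2) unfolding h Q_def by auto
  have int1: "integrable Q (\<lambda>x. x)" "(\<integral>x. x \<partial>Q) = deriv b \<theta>"
    using expfam_moments(1)[OF fam \<phi> \<theta>(1), of 1] expfam_moments(2)[OF fam \<phi> \<theta>(1)]
    by (auto simp: Q_def)
  have "1 = (\<integral>x. 1 + (h * x - h * deriv b \<theta>) \<partial>Q)"
    using int1 Q.prob_space by simp
  also have "\<dots> \<le> (\<integral>x. exp (h * x) * exp (- h * deriv b \<theta>) \<partial>Q)"
  proof (rule integral_mono)
    show "1 + (h * x - h * deriv b \<theta>) \<le> exp (h * x) * exp (- h * deriv b \<theta>)" for x
      using exp_ge_add_one_self[of "h * x - h * deriv b \<theta>"] by (simp add: mult_exp_exp)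
  qed (use int int1 in auto)
  also have "\<dots> = exp ((b \<theta>' - b \<theta>) / \<phi>) * exp (- h * deriv b \<theta>)"
    using int(2) by (subst integral_mult_left_zero) simp
  also have "\<dots> = exp ((b \<theta>' - b \<theta>) / \<phi> - h * deriv b \<theta>)"
    by (simp add: mult_exp_exp)
  finally have "0 \<le> (b \<theta>' - b \<theta>) / \<phi> - h * deriv b \<theta>" by simp
  then have "0 \<le> (b \<theta>' - b \<theta> - deriv b \<theta> * (\<theta>' - \<theta>)) / \<phi>"
    by (simp add: h_def diff_divide_distrib add_divide_distrib algebra_simps)
  then show ?thesis
    using \<phi> by (simp add: zero_le_divide_iff)
qed

lemma distributed_expfam_moments:
  assumes fam: "exp_family \<nu> b c \<phi> \<Theta>" and \<phi>: "\<phi> > 0" and \<theta>: "\<theta> \<in> \<Theta>"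
    and Y: "distributed M \<nu> Y (\<lambda>t. ennreal (expfam_density b c \<phi> \<theta> t))"
  shows "integrable M (\<lambda>\<omega>. Y \<omega> ^ k)"
    and "(\<integral>\<omega>. Y \<omega> \<partial>M) = deriv b \<theta>"
    and "(\<integral>\<omega>. (Y \<omega> - deriv b \<theta>)\<^sup>2 \<partial>M) = \<phi> * (deriv ^^ 2) b \<theta>"
proof -
  have [measurable_cong]: "sets \<nu> = sets borel"
    using fam by (simp add: exp_family_def)
  have eq: "distr M \<nu> Y = expfam_dist \<nu> b c \<phi> \<theta>" and [measurable]: "Y \<in> M \<rightarrow>\<^sub>M \<nu>"
    using Y by (auto simp: distributed_def expfam_dist_def)
  note moments = expfam_moments[OF fam \<phi> \<theta>, folded eq]
  show "integrable M (\<lambda>\<omega>. Y \<omega> ^ k)"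
    using moments(1)[of k] by (subst (asm) integrable_distr_eq) auto
  show "(\<integral>\<omega>. Y \<omega> \<partial>M) = deriv b \<theta>"
    using moments(2) by (subst (asm) integral_distr) auto
  show "(\<integral>\<omega>. (Y \<omega> - deriv b \<theta>)\<^sup>2 \<partial>M) = \<phi> * (deriv ^^ 2) b \<theta>"
    using moments(3) by (subst (asm) integral_distr) auto
qed


section \<open>Lipschitz bounds\<close>

text \<open>The tangents at the two endpoints bracket \<open>b u - b v\<close>, so slope bounds at
  these two points suffice.\<close>

lemma convex_deriv_lipschitz:
  fixes b b' :: "real \<Rightarrow> real"
  assumes tangent: "\<And>u v. u \<in> \<Theta> \<Longrightarrow> v \<in> \<Theta> \<Longrightarrow> b u + b' u * (v - u) \<le> b v"
    and uv: "u \<in> \<Theta>" "v \<in> \<Theta>" and K: "\<bar>b' u\<bar> \<le> K" "\<bar>b' v\<bar> \<le> K"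
  shows "\<bar>b u - b v\<bar> \<le> K * \<bar>u - v\<bar>"
proof -
  have "b u - b v \<le> b' u * (u - v)" "b' v * (u - v) \<le> b u - b v"
    using tangent[OF uv] tangent[OF uv(2,1)] by (auto simp: algebra_simps)
  moreover have "\<bar>b' u * (u - v)\<bar> \<le> K * \<bar>u - v\<bar>" "\<bar>b' v * (u - v)\<bar> \<le> K * \<bar>u - v\<bar>"
    using K by (auto simp: abs_mult intro: mult_right_mono)
  ultimately show ?thesis by linarith
qed

lemma tangent_imp_mono_on:
  fixes b b' :: "real \<Rightarrow> real"
  assumes tangent: "\<And>u v. u \<in> \<Theta> \<Longrightarrow> v \<in> \<Theta> \<Longrightarrow> b u + b' u * (v - u) \<le> b v"
  shows "mono_on \<Theta> b'"
proof (rule mono_onI)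
  fix u v assume uv: "u \<in> \<Theta>" "v \<in> \<Theta>" "u \<le> v"
  show "b' u \<le> b' v"
  proof (cases "u = v")
    case False
    have "b' u * (v - u) \<le> b' v * (v - u)"
      using tangent[OF uv(1,2)] tangent[OF uv(2,1)] by (simp add: algebra_simps)
    then show ?thesis using uv(3) False by simp
  qed simp
qed

text \<open>If the supremum of \<open>T\<close> lies in \<open>\<Theta>\<close>, openness leaves
  room to its right, and the value of \<open>g\<close> there is a bound. Otherwise every point of
  \<open>\<Theta>\<close> lies below some point of \<open>T\<close>, so \<open>C\<close> bounds
  \<open>g\<close> on all of \<open>\<Theta>\<close> and any \<open>\<delta>\<close> will
  do.\<close>

lemma mono_bounded_above_near:
  fixes g :: "real \<Rightarrow> real"
  assumes \<Theta>: "open \<Theta>" "is_interval \<Theta>" and T: "T \<subseteq> \<Theta>" "T \<noteq> {}" "bdd_above T"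
    and g: "mono_on \<Theta> g" "\<And>t. t \<in> T \<Longrightarrow> g t \<le> C"
  obtains \<delta> K where "\<delta> > 0" "\<And>\<theta> t. \<theta> \<in> \<Theta> \<Longrightarrow> t \<in> T \<Longrightarrow> \<theta> \<le> t + \<delta> \<Longrightarrow> g \<theta> \<le> K"
proof (cases "Sup T \<in> \<Theta>")
  case True
  then obtain e where e: "e > 0" "ball (Sup T) e \<subseteq> \<Theta>"
    using \<Theta>(1) open_contains_ball by blast
  have in_\<Theta>: "Sup T + e / 2 \<in> \<Theta>"
    using e by (auto simp: dist_real_def subset_iff)
  show ?thesis
  proof (rule that)
    show "g \<theta> \<le> g (Sup T + e / 2)" if "\<theta> \<in> \<Theta>" "t \<in> T" "\<theta> \<le> t + e / 2" for \<theta> t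
      using g(1) that(1) in_\<Theta> cSup_upper[OF that(2) T(3)] that(3) by (auto dest: mono_onD)
  qed (use e in simp)
next
  case False
  show ?thesis
  proof (rule that[of 1 C])
    fix \<theta> t assume \<theta>: "\<theta> \<in> \<Theta>" and t: "t \<in> T"
    have "\<theta> < Sup T"
    proof (rule ccontr)
      assume "\<not> \<theta> < Sup T"
      moreover have "t \<le> Sup T" using t T(3) by (rule cSup_upper)
      ultimately have "Sup T \<in> \<Theta>"
        using mem_is_interval_1_I[OF \<Theta>(2), of t \<theta> "Sup T"] T(1) t \<theta> by auto
      with False show False by contradiction
    qed
    then obtain t' where "t' \<in> T" "\<theta> < t'"
      using less_cSupD[OF T(2)] by blast
    then show "g \<theta> \<le> C"
      using g \<theta> T(1) by (meson less_imp_le mono_onD order_trans subsetD)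
  qed (simp)
qed

text \<open>The lower bound is the one-sided result for the reflected function
  \<open>\<lambda>x. - g (- x)\<close>, which is again monotone.\<close>

lemma mono_abs_bounded_near:
  fixes g :: "real \<Rightarrow> real"
  assumes \<Theta>: "open \<Theta>" "is_interval \<Theta>" and T: "T \<subseteq> \<Theta>" "T \<noteq> {}" "bounded T"
    and g: "mono_on \<Theta> g" "\<And>t. t \<in> T \<Longrightarrow> \<bar>g t\<bar> \<le> C"
  obtains \<delta> K where "\<delta> > 0" "K \<ge> 0"
    "\<And>\<theta> t. \<theta> \<in> \<Theta> \<Longrightarrow> t \<in> T \<Longrightarrow> \<bar>\<theta> - t\<bar> \<le> \<delta> \<Longrightarrow> \<bar>g \<theta>\<bar> \<le> K"
proof -
  have bdd: "bdd_above T" "bdd_above (uminus ` T)"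
    using T(3) by (auto intro: bounded_imp_bdd_above bounded_imp_bdd_below)
  have up: "g t \<le> C" and lo: "- g t \<le> C" if "t \<in> T" for t
    using g(2)[OF that] by auto
  obtain \<delta>1 K1 where 1: "\<delta>1 > 0"
    "\<And>\<theta> t. \<theta> \<in> \<Theta> \<Longrightarrow> t \<in> T \<Longrightarrow> \<theta> \<le> t + \<delta>1 \<Longrightarrow> g \<theta> \<le> K1"
    using mono_bounded_above_near[OF \<Theta> T(1,2) bdd(1) g(1) up] by blast
  have "open (uminus ` \<Theta>)" "is_interval (uminus ` \<Theta>)" "uminus ` T \<subseteq> uminus ` \<Theta>" "uminus ` T \<noteq> {}"
    using \<Theta> T by (auto simp: open_negations)
  moreover have "mono_on (uminus ` \<Theta>) (\<lambda>x. - g (- x))"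
    using g(1) by (auto simp: mono_on_def)
  moreover have "- g (- t) \<le> C" if "t \<in> uminus ` T" for t
    using lo that by auto
  ultimately obtain \<delta>2 K2 where 2: "\<delta>2 > 0"
    "\<And>\<theta> t. \<theta> \<in> uminus ` \<Theta> \<Longrightarrow> t \<in> uminus ` T \<Longrightarrow> \<theta> \<le> t + \<delta>2 \<Longrightarrow> - g (- \<theta>) \<le> K2"
    using mono_bounded_above_near[of "uminus ` \<Theta>" "uminus ` T" "\<lambda>x. - g (- x)" C] bdd(2) by metis
  show ?thesis
  proof (rule that[of "min \<delta>1 \<delta>2" "\<bar>K1\<bar> + \<bar>K2\<bar>"])
    fix \<theta> t assume *: "\<theta> \<in> \<Theta>" "t \<in> T" "\<bar>\<theta> - t\<bar> \<le> min \<delta>1 \<delta>2"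
    have "g \<theta> \<le> K1" using 1(2)[of \<theta> t] * by auto
    moreover have "- g \<theta> \<le> K2" using 2(2)[of "- \<theta>" "- t"] * by auto
    ultimately show "\<bar>g \<theta>\<bar> \<le> \<bar>K1\<bar> + \<bar>K2\<bar>" by linarith
  qed (use 1 2 in auto)
qed

lemma tinner_eq_sum:
  "tinner D p T U = (\<Sum>k<(\<Prod>d<D. p d). T (multi_index D p k) * U (multi_index D p k))"
  by (simp add: tinner_def tvec_def scalar_prod_def lessThan_atLeast0)

lemma tnorm_eq_sum: "tnorm D p T = sqrt (\<Sum>k<(\<Prod>d<D. p d). (T (multi_index D p k))\<^sup>2)"
  by (simp add: tnorm_def tvec_def scalar_prod_def lessThan_atLeast0 power2_eq_square)

lemma abs_entry_le_tnorm:
  assumes "k < (\<Prod>d<D. p d)"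
  shows "\<bar>T (multi_index D p k)\<bar> \<le> tnorm D p T"
proof -
  have "(T (multi_index D p k))\<^sup>2 \<le> (\<Sum>k<(\<Prod>d<D. p d). (T (multi_index D p k))\<^sup>2)"
    using assms by (intro member_le_sum) auto
  then show ?thesis
    unfolding tnorm_eq_sum using real_sqrt_le_mono[of "(T (multi_index D p k))\<^sup>2"] by simp
qed

lemma tinner_diff_le:
  assumes "\<And>k. k < (\<Prod>d<D. p d) \<Longrightarrow> \<bar>T (multi_index D p k) - T' (multi_index D p k)\<bar> \<le> e"
    and "tnorm D p U \<le> C"
  shows "\<bar>tinner D p T U - tinner D p T' U\<bar> \<le> real (\<Prod>d<D. p d) * (e * C)"
proof -
  let ?i = "multi_index D p"
  have "\<bar>tinner D p T U - tinner D p T' U\<bar>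
      = \<bar>\<Sum>k<(\<Prod>d<D. p d). (T (?i k) - T' (?i k)) * U (?i k)\<bar>"
    by (simp add: tinner_eq_sum sum_subtractf algebra_simps)
  also have "\<dots> \<le> (\<Sum>k<(\<Prod>d<D. p d). \<bar>T (?i k) - T' (?i k)\<bar> * \<bar>U (?i k)\<bar>)"
    by (rule order_trans[OF sum_abs]) (simp add: abs_mult)
  also have "\<dots> \<le> (\<Sum>k<(\<Prod>d<D. p d). e * C)"
  proof (rule sum_mono)
    fix k assume "k \<in> {..<(\<Prod>d<D. p d)}"
    then have k: "k < (\<Prod>d<D. p d)" by simp
    show "\<bar>T (?i k) - T' (?i k)\<bar> * \<bar>U (?i k)\<bar> \<le> e * C"
      using assms(1)[OF k] assms(2) abs_entry_le_tnorm[OF k, of U]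
      by (intro mult_mono) auto
  qed
  finally show ?thesis by simp
qed

lemma lin_pred_tavg: "lin_pred D p X (tavg S w T) i = (\<Sum>s=1..S. w s * lin_pred D p X (T s) i)"
  by (simp add: lin_pred_def tinner_eq_sum tavg_def sum_distrib_left sum_distrib_right mult.assoc)
     (rule sum.swap)

lemma abs_prod_le_power:
  fixes f :: "nat \<Rightarrow> real"
  assumes "\<And>d. d < D \<Longrightarrow> \<bar>f d\<bar> \<le> B"
  shows "\<bar>\<Prod>d<D. f d\<bar> \<le> B ^ D"
  using prod_mono[of "{..<D}" "\<lambda>d. \<bar>f d\<bar>" "\<lambda>_. B"] assms by (simp add: abs_prod)

text \<open>Factors are exchanged one at a time. Since \<open>1 \<le> B\<close>, each of the
  \<open>D\<close> exchanges can be charged the same power of \<open>B\<close>.\<close>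

lemma abs_prod_diff_le:
  fixes f g :: "nat \<Rightarrow> real"
  assumes "\<And>d. d < D \<Longrightarrow> \<bar>f d\<bar> \<le> B" "\<And>d. d < D \<Longrightarrow> \<bar>g d\<bar> \<le> B"
    and "\<And>d. d < D \<Longrightarrow> \<bar>f d - g d\<bar> \<le> e" and B: "1 \<le> B" and e: "0 \<le> e"
  shows "\<bar>(\<Prod>d<D. f d) - (\<Prod>d<D. g d)\<bar> \<le> real D * B ^ D * e"
  using assms(1-3)
proof (induction D)
  case (Suc D)
  let ?f = "\<Prod>d<D. f d" and ?g = "\<Prod>d<D. g d"
  have "\<bar>?f - ?g\<bar> * \<bar>f D\<bar> \<le> real D * B ^ D * e * B"
    using Suc B e by (intro mult_mono) auto
  moreover have "\<bar>?g\<bar> * \<bar>f D - g D\<bar> \<le> B ^ D * e"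
    using Suc.prems B e by (intro mult_mono abs_prod_le_power) auto
  moreover have "B ^ D * e \<le> B ^ D * e * B"
    using B e by (intro mult_left_mono[of 1 B, simplified]) auto
  moreover have "?f * f D - ?g * g D = (?f - ?g) * f D + ?g * (f D - g D)"
    by (simp add: algebra_simps)
  then have "\<bar>?f * f D - ?g * g D\<bar> \<le> \<bar>?f - ?g\<bar> * \<bar>f D\<bar> + \<bar>?g\<bar> * \<bar>f D - g D\<bar>"
    using abs_triangle_ineq[of "(?f - ?g) * f D" "?g * (f D - g D)"] by (simp add: abs_mult)
  ultimately show ?case by (simp add: algebra_simps)
qed simp

lemma abs_cp_le:
  assumes "\<And>d c. d < D \<Longrightarrow> c < R \<Longrightarrow> \<bar>F d (i d) c\<bar> \<le> B"
  shows "\<bar>cp D R F i\<bar> \<le> real R * B ^ D"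
proof -
  have "\<bar>cp D R F i\<bar> \<le> (\<Sum>c<R. \<bar>outer_prod D (\<lambda>d k. F d k c) i\<bar>)"
    unfolding cp_def by (rule sum_abs)
  also have "\<dots> \<le> (\<Sum>c<R. B ^ D)"
    unfolding outer_prod_def by (intro sum_mono abs_prod_le_power assms) auto
  finally show ?thesis by simp
qed

lemma abs_cp_diff_le:
  assumes "\<And>d c. d < D \<Longrightarrow> c < R \<Longrightarrow> \<bar>F d (i d) c\<bar> \<le> B"
    and "\<And>d c. d < D \<Longrightarrow> c < R \<Longrightarrow> \<bar>G d (i d) c\<bar> \<le> B"
    and "\<And>d c. d < D \<Longrightarrow> c < R \<Longrightarrow> \<bar>F d (i d) c - G d (i d) c\<bar> \<le> e"
    and B: "1 \<le> B" and e: "0 \<le> e"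
  shows "\<bar>cp D R F i - cp D R G i\<bar> \<le> real R * (real D * B ^ D * e)"
proof -
  have "\<bar>cp D R F i - cp D R G i\<bar>
      \<le> (\<Sum>c<R. \<bar>outer_prod D (\<lambda>d k. F d k c) i - outer_prod D (\<lambda>d k. G d k c) i\<bar>)"
    unfolding cp_def sum_subtractf[symmetric] by (rule sum_abs)
  also have "\<dots> \<le> (\<Sum>c<R. real D * B ^ D * e)"
    unfolding outer_prod_def by (intro sum_mono abs_prod_diff_le assms) auto
  finally show ?thesis by simp
qed

lemma multi_index_less:
  assumes "d < D" "1 \<le> p d"
  shows "multi_index D p k d < p d"
  using assms by (simp add: multi_index_def)

lemma abs_entry_diff_le_factor_dist:
  assumes "d < D" "k < p d" "c < R"
  shows "\<bar>F d k c - G d k c\<bar> \<le> factor_dist D p R F G"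
proof -
  have "(F d k c - G d k c)\<^sup>2 \<le> (\<Sum>c<R. (F d k c - G d k c)\<^sup>2)"
    using assms by (intro member_le_sum) auto
  also have "\<dots> \<le> (\<Sum>k<p d. \<Sum>c<R. (F d k c - G d k c)\<^sup>2)"
    using assms by (intro member_le_sum[where f = "\<lambda>k. \<Sum>c<R. (F d k c - G d k c)\<^sup>2"] sum_nonneg) auto
  also have "\<dots> \<le> (\<Sum>d<D. \<Sum>k<p d. \<Sum>c<R. (F d k c - G d k c)\<^sup>2)"
    using assms
    by (intro member_le_sum[where f = "\<lambda>d. \<Sum>k<p d. \<Sum>c<R. (F d k c - G d k c)\<^sup>2"] sum_nonneg) auto
  finally show ?thesis
    unfolding factor_dist_def using real_sqrt_le_mono[of "(F d k c - G d k c)\<^sup>2"] by simp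
qed

lemma factor_dist_nonneg: "0 \<le> factor_dist D p R F G"
  unfolding factor_dist_def by (intro real_sqrt_ge_zero sum_nonneg) auto

text \<open>Compactness refers to the product topology, so boundedness is obtained coordinate by
  coordinate. Summing over the finitely many relevant coordinates gives one bound, and the extra 1
  ensures \<open>1 \<le> B\<close>.\<close>

lemma compact_factors_bounded:
  fixes \<BB> :: "factors set"
  assumes "compact \<BB>"
  obtains B where "1 \<le> B" "\<And>F d k c. F \<in> \<BB> \<Longrightarrow> d < D \<Longrightarrow> k < p d \<Longrightarrow> c < R \<Longrightarrow> \<bar>F d k c\<bar> \<le> B"
proof -
  have "\<exists>B. \<forall>F\<in>\<BB>. \<bar>F d k c\<bar> \<le> B" for d k c
  proof -
    have "continuous_on \<BB> (\<lambda>F. F d k c)"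
      by (rule continuous_on_product_then_coordinatewise[where f = "\<lambda>F. F d k"],
          rule continuous_on_product_then_coordinatewise[where f = "\<lambda>F. F d"],
          rule continuous_on_product_then_coordinatewise[where f = "\<lambda>F. F"],
          rule continuous_on_id)
    then have "compact ((\<lambda>F. F d k c) ` \<BB>)"
      using assms by (rule compact_continuous_image)
    then show ?thesis
      by (auto dest!: compact_imp_bounded simp: bounded_iff)
  qed
  then obtain B where B: "\<And>d k c F. F \<in> \<BB> \<Longrightarrow> \<bar>F d k c\<bar> \<le> B d k c" by metis
  show ?thesis
  proof (rule that)
    show "1 \<le> 1 + (\<Sum>d<D. \<Sum>k<p d. \<Sum>c<R. \<bar>B d k c\<bar>)"
      by (simp add: sum_nonneg)
    fix F d k c assume *: "F \<in> \<BB>" "d < D" "k < p d" "c < R"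
    have "\<bar>F d k c\<bar> \<le> \<bar>B d k c\<bar>" using B[OF *(1), of d k c] by simp
    also have "\<dots> \<le> (\<Sum>c<R. \<bar>B d k c\<bar>)"
      using * by (intro member_le_sum) auto
    also have "\<dots> \<le> (\<Sum>k<p d. \<Sum>c<R. \<bar>B d k c\<bar>)"
      using * by (intro member_le_sum[where f = "\<lambda>k. \<Sum>c<R. \<bar>B d k c\<bar>"] sum_nonneg) auto
    also have "\<dots> \<le> (\<Sum>d<D. \<Sum>k<p d. \<Sum>c<R. \<bar>B d k c\<bar>)"
      using * by (intro member_le_sum[where f = "\<lambda>d. \<Sum>k<p d. \<Sum>c<R. \<bar>B d k c\<bar>"] sum_nonneg) auto
    finally show "\<bar>F d k c\<bar> \<le> 1 + (\<Sum>d<D. \<Sum>k<p d. \<Sum>c<R. \<bar>B d k c\<bar>)" by simp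
  qed
qed

text \<open>
  Only one of the two factorizations has to lie in the compact set: an estimate within distance
  one of its target has entries bounded by one more than those of the target.
\<close>

lemma lin_pred_cp_lipschitz:
  fixes \<BB> :: "factors set"
  assumes "compact \<BB>" and p: "\<And>d. d < D \<Longrightarrow> 1 \<le> p d" and C: "0 \<le> C"
  obtains L where "0 \<le> L"
    "\<And>X i F. tnorm D p (X i) \<le> C \<Longrightarrow> F \<in> \<BB> \<Longrightarrow> \<bar>lin_pred D p X (cp D R F) i\<bar> \<le> L"
    "\<And>X i F G. tnorm D p (X i) \<le> C \<Longrightarrow> F \<in> \<BB> \<Longrightarrow> factor_dist D p R G F \<le> 1 \<Longrightarrow>
       \<bar>lin_pred D p X (cp D R G) i - lin_pred D p X (cp D R F) i\<bar> \<le> L * factor_dist D p R G F"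
proof -
  obtain B where B: "1 \<le> B"
    "\<And>F d k c. F \<in> \<BB> \<Longrightarrow> d < D \<Longrightarrow> k < p d \<Longrightarrow> c < R \<Longrightarrow> \<bar>F d k c\<bar> \<le> B"
    using compact_factors_bounded[OF assms(1), of D p R] by blast
  define P where "P = real (\<Prod>d<D. p d)"
  define L1 where "L1 = P * (real R * B ^ D * C)"
  define L2 where "L2 = P * (real R * (real D * (B + 1) ^ D) * C)"
  have L: "0 \<le> L1" "0 \<le> L2" unfolding L1_def L2_def P_def using B(1) C by (auto intro!: mult_nonneg_nonneg prod_nonneg)
  have idx: "multi_index D p k d < p d" if "d < D" for k d
    using that p by (intro multi_index_less) auto
  show ?thesis
  proof (rule that)
    show "0 \<le> L1 + L2" using L by simp
    show "\<bar>lin_pred D p X (cp D R F) i\<bar> \<le> L1 + L2" if "tnorm D p (X i) \<le> C" "F \<in> \<BB>" for X i F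
    proof -
      \<comment> \<open>Comparison with the zero tensor turns the difference estimate into a bound
        on size.\<close>
      have "\<bar>tinner D p (cp D R F) (X i) - tinner D p (\<lambda>_. 0) (X i)\<bar> \<le> P * (real R * B ^ D * C)"
        unfolding P_def using that B idx
        by (intro tinner_diff_le) (auto intro!: abs_cp_le)
      then show ?thesis using L
        by (simp add: lin_pred_def L1_def tinner_eq_sum[of _ _ "\<lambda>_. 0"])
    qed
    show "\<bar>lin_pred D p X (cp D R G) i - lin_pred D p X (cp D R F) i\<bar>
        \<le> (L1 + L2) * factor_dist D p R G F"
      if X: "tnorm D p (X i) \<le> C" and F: "F \<in> \<BB>" and G: "factor_dist D p R G F \<le> 1" for X i F G
    proof -
      let ?e = "factor_dist D p R G F"
      have le_B: "\<bar>F d (multi_index D p k d) c\<bar> \<le> B + 1" if "d < D" "c < R" for k d c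
        using B(2)[OF F that(1) idx[OF that(1)] that(2), of k] by simp
      have diff: "\<bar>G d (multi_index D p k d) c - F d (multi_index D p k d) c\<bar> \<le> ?e"
        if "d < D" "c < R" for k d c
        using that idx by (intro abs_entry_diff_le_factor_dist) auto
      have "\<bar>G d (multi_index D p k d) c\<bar> \<le> B + 1" if "d < D" "c < R" for k d c
        using B(2)[OF F that(1) idx[OF that(1)] that(2), of k] diff[OF that, of k] G by linarith
      then have "\<bar>tinner D p (cp D R G) (X i) - tinner D p (cp D R F) (X i)\<bar>
          \<le> P * (real R * (real D * (B + 1) ^ D * ?e) * C)"
        unfolding P_def using X B(1) le_B diff
        by (intro tinner_diff_le abs_cp_diff_le) (auto simp: factor_dist_nonneg)
      also have "\<dots> = L2 * ?e" by (simp add: L2_def)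
      also have "\<dots> \<le> (L1 + L2) * ?e"
        using L by (intro mult_right_mono) (auto simp: factor_dist_nonneg)
      finally show ?thesis by (simp add: lin_pred_def)
    qed
  qed
qed

lemma sum_cv_fold:
  assumes "J dvd n" "J > 0"
  shows "(\<Sum>j=1..J. \<Sum>i\<in>cv_fold n J j. g i) = (\<Sum>i=1..n. g i)"
proof -
  define m where "m = n div J"
  have n: "n = J * m" using assms by (simp add: m_def)
  \<comment> \<open>Folds and observations are numbered from 1, the blocks of
    \<open>sum.nat_group\<close> from 0; both shifts are absorbed by \<open>Suc\<close>.\<close>
  have fold: "(\<Sum>i\<in>cv_fold n J (Suc j). g i) = (\<Sum>i\<in>{j * m..<j * m + m}. g (Suc i))" for j
    unfolding cv_fold_def m_def[symmetric]
    by (rule sum.reindex_bij_witness[where j = "\<lambda>i. i - 1" and i = Suc])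
       (auto simp: image_iff intro!: bexI[of _ "Suc _ - _"])
  have "(\<Sum>j=1..J. \<Sum>i\<in>cv_fold n J j. g i) = (\<Sum>j<J. \<Sum>i\<in>cv_fold n J (Suc j). g i)"
    by (rule sum.reindex_bij_witness[where j = "\<lambda>i. i - 1" and i = Suc]) auto
  also have "\<dots> = (\<Sum>i<n. g (Suc i))"
    unfolding fold by (simp add: n sum.nat_group)
  also have "\<dots> = (\<Sum>i=1..n. g i)"
    by (rule sum.reindex_bij_witness[where j = Suc and i = "\<lambda>i. i - 1"]) auto
  finally show ?thesis .
qed


section \<open>Boundedness in probability\<close>

text \<open>Induction peels off one variable, which is independent of the sum of the others; the
  cross term factorizes and vanishes because the variables are centred.\<close>

lemma (in prob_space) second_moment_sum_indep:
  fixes Z :: "'i \<Rightarrow> 'a \<Rightarrow> real"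
  assumes "finite I" "indep_vars (\<lambda>_. borel) Z I"
    and "\<And>i. i \<in> I \<Longrightarrow> integrable M (\<lambda>\<omega>. (Z i \<omega>)\<^sup>2)" "\<And>i. i \<in> I \<Longrightarrow> expectation (Z i) = 0"
  shows "integrable M (\<lambda>\<omega>. (\<Sum>i\<in>I. Z i \<omega>)\<^sup>2)"
    and "expectation (\<lambda>\<omega>. (\<Sum>i\<in>I. Z i \<omega>)\<^sup>2) = (\<Sum>i\<in>I. expectation (\<lambda>\<omega>. (Z i \<omega>)\<^sup>2))"
proof -
  have "integrable M (\<lambda>\<omega>. (\<Sum>i\<in>I. Z i \<omega>)\<^sup>2) \<and>
      expectation (\<lambda>\<omega>. (\<Sum>i\<in>I. Z i \<omega>)\<^sup>2) = (\<Sum>i\<in>I. expectation (\<lambda>\<omega>. (Z i \<omega>)\<^sup>2))"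
    using assms
  proof (induction I)
    case (insert j I)
    have rv: "random_variable borel (Z i)" if "i \<in> insert j I" for i
      using insert.prems(1) that by (auto simp: indep_vars_def2)
    have int: "integrable M (Z i)" if "i \<in> insert j I" for i
      using rv[OF that] insert.prems(2)[OF that] by (rule square_integrable_imp_integrable)
    let ?S = "\<lambda>\<omega>. \<Sum>i\<in>I. Z i \<omega>"
    have S: "integrable M ?S" using int by auto
    have "indep_vars (\<lambda>_. borel) Z I"
      using insert.prems(1) by (rule indep_vars_subset) auto
    then have IH: "integrable M (\<lambda>\<omega>. (?S \<omega>)\<^sup>2)"
        "expectation (\<lambda>\<omega>. (?S \<omega>)\<^sup>2) = (\<Sum>i\<in>I. expectation (\<lambda>\<omega>. (Z i \<omega>)\<^sup>2))"
      using insert by auto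
    have "indep_var borel (Z j) borel ?S"
      by (rule indep_vars_sum[OF insert.hyps(1,2) insert.prems(1)])
    from indep_var_integrable[OF this int S] indep_var_lebesgue_integral[OF this int S]
    have prod: "integrable M (\<lambda>\<omega>. Z j \<omega> * ?S \<omega>)" "expectation (\<lambda>\<omega>. Z j \<omega> * ?S \<omega>) = 0"
      using insert.prems(3) by auto
    have eq: "(\<Sum>i\<in>insert j I. Z i \<omega>)\<^sup>2 = (Z j \<omega>)\<^sup>2 + 2 * (Z j \<omega> * ?S \<omega>) + (?S \<omega>)\<^sup>2" for \<omega>
      using insert.hyps by (simp add: power2_sum algebra_simps)
    show ?case
      unfolding eq using IH prod insert.hyps insert.prems(2) by simp
  qed simp
  then show "integrable M (\<lambda>\<omega>. (\<Sum>i\<in>I. Z i \<omega>)\<^sup>2)"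
    "expectation (\<lambda>\<omega>. (\<Sum>i\<in>I. Z i \<omega>)\<^sup>2) = (\<Sum>i\<in>I. expectation (\<lambda>\<omega>. (Z i \<omega>)\<^sup>2))"
    by auto
qed

text \<open>
  Exceptional sets are required to be measurable, but \<open>Z n\<close> is not: dominated quantities then
  inherit the property without any measurability check.
\<close>

definition bounded_in_prob ::
  "nat filter \<Rightarrow> (nat \<Rightarrow> 'a measure) \<Rightarrow> (nat \<Rightarrow> 'a \<Rightarrow> real) \<Rightarrow> bool" where
  "bounded_in_prob \<F> M Z \<longleftrightarrow>
     (\<forall>\<epsilon>>0. \<exists>K. \<forall>\<^sub>F n in \<F>. \<exists>A\<in>sets (M n). measure (M n) A < \<epsilon> \<and>
        (\<forall>\<omega>\<in>space (M n) - A. \<bar>Z n \<omega>\<bar> \<le> K))"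

lemma bounded_in_prob_add:
  assumes "bounded_in_prob \<F> M Y" "bounded_in_prob \<F> M Z"
  shows "bounded_in_prob \<F> M (\<lambda>n \<omega>. Y n \<omega> + Z n \<omega>)"
  unfolding bounded_in_prob_def
proof (intro allI impI)
  fix \<epsilon> :: real assume "\<epsilon> > 0"
  then have \<epsilon>: "\<epsilon> / 2 > 0" by simp
  obtain K1 K2 where K:
    "\<forall>\<^sub>F n in \<F>. \<exists>A\<in>sets (M n). measure (M n) A < \<epsilon> / 2 \<and> (\<forall>\<omega>\<in>space (M n) - A. \<bar>Y n \<omega>\<bar> \<le> K1)"
    "\<forall>\<^sub>F n in \<F>. \<exists>A\<in>sets (M n). measure (M n) A < \<epsilon> / 2 \<and> (\<forall>\<omega>\<in>space (M n) - A. \<bar>Z n \<omega>\<bar> \<le> K2)"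
    using assms \<epsilon> unfolding bounded_in_prob_def by meson
  show "\<exists>K. \<forall>\<^sub>F n in \<F>. \<exists>A\<in>sets (M n). measure (M n) A < \<epsilon> \<and>
      (\<forall>\<omega>\<in>space (M n) - A. \<bar>Y n \<omega> + Z n \<omega>\<bar> \<le> K)"
  proof (rule exI[of _ "K1 + K2"], use K in eventually_elim)
    case (elim n)
    then obtain A B where A: "A \<in> sets (M n)" "measure (M n) A < \<epsilon> / 2"
        "\<forall>\<omega>\<in>space (M n) - A. \<bar>Y n \<omega>\<bar> \<le> K1"
      and B: "B \<in> sets (M n)" "measure (M n) B < \<epsilon> / 2"
        "\<forall>\<omega>\<in>space (M n) - B. \<bar>Z n \<omega>\<bar> \<le> K2" by blast
    have "measure (M n) (A \<union> B) < \<epsilon>"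
      using measure_Un_le[OF A(1) B(1)] A(2) B(2) by linarith
    moreover have "\<bar>Y n \<omega> + Z n \<omega>\<bar> \<le> K1 + K2" if "\<omega> \<in> space (M n) - (A \<union> B)" for \<omega>
    proof -
      have "\<bar>Y n \<omega>\<bar> \<le> K1" "\<bar>Z n \<omega>\<bar> \<le> K2" using A(3) B(3) that by auto
      then show ?thesis by linarith
    qed
    ultimately show ?case using A(1) B(1) by blast
  qed
qed

lemma bounded_in_prob_dominated:
  assumes "bounded_in_prob \<F> M Z"
    and "\<forall>\<^sub>F n in \<F>. \<forall>\<omega>\<in>space (M n). \<bar>Y n \<omega>\<bar> \<le> C + \<bar>Z n \<omega>\<bar>"
  shows "bounded_in_prob \<F> M Y"
  unfolding bounded_in_prob_def
proof (intro allI impI)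
  fix \<epsilon> :: real assume "\<epsilon> > 0"
  then obtain K where K: "\<forall>\<^sub>F n in \<F>. \<exists>A\<in>sets (M n). measure (M n) A < \<epsilon> \<and>
      (\<forall>\<omega>\<in>space (M n) - A. \<bar>Z n \<omega>\<bar> \<le> K)"
    using assms(1) unfolding bounded_in_prob_def by meson
  show "\<exists>K. \<forall>\<^sub>F n in \<F>. \<exists>A\<in>sets (M n). measure (M n) A < \<epsilon> \<and>
      (\<forall>\<omega>\<in>space (M n) - A. \<bar>Y n \<omega>\<bar> \<le> K)"
  proof (rule exI[of _ "C + K"], use K assms(2) in eventually_elim)
    case (elim n)
    then obtain A where A: "A \<in> sets (M n)" "measure (M n) A < \<epsilon>"
        "\<forall>\<omega>\<in>space (M n) - A. \<bar>Z n \<omega>\<bar> \<le> K" by blast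
    have "\<bar>Y n \<omega>\<bar> \<le> C + K" if "\<omega> \<in> space (M n) - A" for \<omega>
    proof -
      have "\<bar>Y n \<omega>\<bar> \<le> C + \<bar>Z n \<omega>\<bar>" using elim(2) that by auto
      also have "\<dots> \<le> C + K" using A(3) that by auto
      finally show ?thesis .
    qed
    then show ?case using A by blast
  qed
qed

lemma bounded_in_prob_zero: "bounded_in_prob \<F> M (\<lambda>_ _. 0)"
  unfolding bounded_in_prob_def by (intro allI impI exI[of _ 0] always_eventually bexI[of _ "{}"]) auto

lemma bounded_in_prob_abs:
  assumes "bounded_in_prob \<F> M Z"
  shows "bounded_in_prob \<F> M (\<lambda>n \<omega>. \<bar>Z n \<omega>\<bar>)"
  using assms by (rule bounded_in_prob_dominated[where C = 0]) simp

lemma bounded_in_prob_sum: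
  assumes "finite I" "\<And>s. s \<in> I \<Longrightarrow> bounded_in_prob \<F> M (Z s)"
  shows "bounded_in_prob \<F> M (\<lambda>n \<omega>. \<Sum>s\<in>I. Z s n \<omega>)"
  using assms
  by (induction I) (simp_all add: bounded_in_prob_zero bounded_in_prob_add)

text \<open>Measurability of \<open>Z n\<close> is what admits the event of exceeding
  \<open>K * r n\<close> as an exceptional set.\<close>

lemma bigO_prob_imp_bounded_in_prob:
  assumes Z: "bigO_prob \<F> M Z r"
    and ev: "\<forall>\<^sub>F n in \<F>. Z n \<in> borel_measurable (M n) \<and> r n > 0"
  shows "bounded_in_prob \<F> M (\<lambda>n \<omega>. Z n \<omega> / r n)"
  unfolding bounded_in_prob_def
proof (intro allI impI)
  fix \<epsilon> :: real assume "\<epsilon> > 0"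
  then obtain K where K: "\<forall>\<^sub>F n in \<F>. measure (M n) {\<omega> \<in> space (M n). \<bar>Z n \<omega>\<bar> > K * r n} < \<epsilon>"
    using Z unfolding bigO_prob_def by meson
  show "\<exists>K. \<forall>\<^sub>F n in \<F>. \<exists>A\<in>sets (M n). measure (M n) A < \<epsilon> \<and>
      (\<forall>\<omega>\<in>space (M n) - A. \<bar>Z n \<omega> / r n\<bar> \<le> K)"
  proof (rule exI[of _ K], use K ev in eventually_elim)
    case (elim n)
    then have [measurable]: "Z n \<in> borel_measurable (M n)" and r: "r n > 0" by auto
    show ?case
    proof (intro bexI[of _ "{\<omega> \<in> space (M n). \<bar>Z n \<omega>\<bar> > K * r n}"] conjI ballI)
      fix \<omega> assume "\<omega> \<in> space (M n) - {\<omega> \<in> space (M n). \<bar>Z n \<omega>\<bar> > K * r n}"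
      then show "\<bar>Z n \<omega> / r n\<bar> \<le> K" using r by (auto simp: abs_divide pos_divide_le_eq)
    qed (use elim in auto)
  qed
qed

lemma bounded_in_prob_expectation:
  assumes "\<forall>\<^sub>F n in \<F>. integrable (M n) (Z n) \<and> (\<forall>\<omega>. 0 \<le> Z n \<omega>) \<and> (\<integral>\<omega>. Z n \<omega> \<partial>M n) \<le> C"
  shows "bounded_in_prob \<F> M Z"
  unfolding bounded_in_prob_def
proof (intro allI impI)
  fix \<epsilon> :: real assume \<epsilon>: "\<epsilon> > 0"
  \<comment> \<open>Chosen for Markov's inequality: the absolute value and the added 1 give
    \<open>K > 0\<close> and \<open>C / K < \<epsilon>\<close> whatever the sign of
    \<open>C\<close>.\<close>
  define K where "K = 2 * (\<bar>C\<bar> + 1) / \<epsilon>"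
  have K: "K > 0" using \<epsilon> by (simp add: K_def)
  have "C / K < \<epsilon>"
  proof -
    have "C < K * \<epsilon>" using \<epsilon> by (simp add: K_def)
    then show ?thesis using K by (simp add: pos_divide_less_eq mult.commute)
  qed
  show "\<exists>K. \<forall>\<^sub>F n in \<F>. \<exists>A\<in>sets (M n). measure (M n) A < \<epsilon> \<and>
      (\<forall>\<omega>\<in>space (M n) - A. \<bar>Z n \<omega>\<bar> \<le> K)"
  proof (rule exI[of _ K], use assms in eventually_elim)
    case (elim n)
    then have int: "integrable (M n) (Z n)" and le: "(\<integral>\<omega>. Z n \<omega> \<partial>M n) \<le> C"
      and nonneg: "\<And>\<omega>. 0 \<le> Z n \<omega>" by auto
    note [measurable] = borel_measurable_integrable[OF int]
    have "measure (M n) {\<omega> \<in> space (M n). K \<le> Z n \<omega>} \<le> (\<integral>\<omega>. Z n \<omega> \<partial>M n) / K"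
      using int K nonneg by (intro integral_Markov_inequality_measure[where A = "{}"]) auto
    also have "\<dots> \<le> C / K"
      using le K by (intro divide_right_mono) auto
    finally have "measure (M n) {\<omega> \<in> space (M n). K \<le> Z n \<omega>} < \<epsilon>"
      using \<open>C / K < \<epsilon>\<close> by linarith
    then show ?case
      using nonneg by (intro bexI[of _ "{\<omega> \<in> space (M n). K \<le> Z n \<omega>}"]) auto
  qed
qed

text \<open>This isolates the randomness in \<open>Z\<close>: where \<open>Z\<close> is at most
  \<open>K\<close>, the estimate for \<open>V\<close> is deterministic, so the event of a large
  deviation lies inside the exceptional set of \<open>Z\<close>.\<close>

lemma tendsto_prob_bounded_in_prob:
  assumes Z: "bounded_in_prob \<F> M Z"
    and V: "\<And>K \<epsilon>. \<epsilon> > 0 \<Longrightarrow>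
      \<forall>\<^sub>F n in \<F>. \<forall>\<omega>\<in>space (M n). \<bar>Z n \<omega>\<bar> \<le> K \<longrightarrow> \<bar>V n \<omega> - l\<bar> \<le> \<epsilon>"
    and M: "\<forall>\<^sub>F n in \<F>. finite_measure (M n)"
  shows "tendsto_prob \<F> M V l"
  unfolding tendsto_prob_def
proof (intro allI impI tendstoI)
  fix \<epsilon> e :: real assume \<epsilon>: "\<epsilon> > 0" and e: "e > 0"
  obtain K where K: "\<forall>\<^sub>F n in \<F>. \<exists>A\<in>sets (M n). measure (M n) A < e \<and>
      (\<forall>\<omega>\<in>space (M n) - A. \<bar>Z n \<omega>\<bar> \<le> K)"
    using Z e unfolding bounded_in_prob_def by meson
  from K V[OF \<epsilon>, of K] M
  show "\<forall>\<^sub>F n in \<F>. dist (measure (M n) {\<omega> \<in> space (M n). \<bar>V n \<omega> - l\<bar> > \<epsilon>}) 0 < e"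
  proof eventually_elim
    case (elim n)
    then obtain A where A: "A \<in> sets (M n)" "measure (M n) A < e"
        "\<forall>\<omega>\<in>space (M n) - A. \<bar>Z n \<omega>\<bar> \<le> K" by blast
    have "{\<omega> \<in> space (M n). \<bar>V n \<omega> - l\<bar> > \<epsilon>} \<subseteq> A"
      using A(3) elim(2) by force
    from finite_measure.finite_measure_mono[OF elim(3) this A(1)] A(2)
    show ?case by simp
  qed
qed

lemma along_le_sequentially: "along N \<le> sequentially"
  by (simp add: along_def)

lemma eventually_along_mem: "\<forall>\<^sub>F n in along N. n \<in> N"
  by (simp add: along_def eventually_inf_principal)

text \<open>The assumption is the tangent inequality at the true natural parameter, where the slope
  of \<open>b\<close> will be the mean.\<close>

lemma KL_loss_nonneg:
  assumes "\<phi> > 0" "\<And>i. i \<in> {1..n} \<Longrightarrow> b (\<eta>0 i) + \<mu> i * (\<eta> i - \<eta>0 i) \<le> b (\<eta> i)"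
  shows "0 \<le> KL_loss b \<phi> n \<mu> \<eta>0 \<eta>"
  unfolding KL_loss_def using assms
  by (intro mult_nonneg_nonneg sum_nonneg) (auto simp: algebra_simps)

lemma KL_loss_diff_le:
  assumes \<phi>: "\<phi> > 0"
    and b: "\<And>i. i \<in> {1..n} \<Longrightarrow> \<bar>b (u i) - b (v i)\<bar> \<le> \<kappa> * d"
    and uv: "\<And>i. i \<in> {1..n} \<Longrightarrow> \<bar>u i - v i\<bar> \<le> d"
    and \<mu>: "\<And>i. i \<in> {1..n} \<Longrightarrow> \<bar>\<mu> i\<bar> \<le> m"
  shows "\<bar>KL_loss b \<phi> n \<mu> \<eta>0 u - KL_loss b \<phi> n \<mu> \<eta>0 v\<bar> \<le> 2 / \<phi> * (real n * ((\<kappa> + m) * d))"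
proof -
  have "\<bar>\<Sum>i=1..n. (b (u i) - b (v i)) - \<mu> i * (u i - v i)\<bar> \<le> (\<Sum>i=1..n. (\<kappa> + m) * d)"
  proof (rule order_trans[OF sum_abs sum_mono])
    fix i assume i: "i \<in> {1..n}"
    have "\<bar>\<mu> i * (u i - v i)\<bar> \<le> m * d"
      unfolding abs_mult using uv[OF i] \<mu>[OF i] by (intro mult_mono) auto
    then show "\<bar>(b (u i) - b (v i)) - \<mu> i * (u i - v i)\<bar> \<le> (\<kappa> + m) * d"
      using b[OF i] by (simp add: algebra_simps)
  qed
  moreover have "KL_loss b \<phi> n \<mu> \<eta>0 u - KL_loss b \<phi> n \<mu> \<eta>0 v
      = 2 / \<phi> * (\<Sum>i=1..n. (b (u i) - b (v i)) - \<mu> i * (u i - v i))"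
    unfolding KL_loss_def right_diff_distrib[symmetric] sum_subtractf[symmetric]
    by (simp add: algebra_simps)
  ultimately show ?thesis
    using \<phi> by (simp add: abs_mult divide_right_mono)
qed

text \<open>Replacing the fold estimates \<open>u j\<close> by the common \<open>v\<close> costs
  \<open>?A\<close>. The fold sums then merge into one sum over \<open>{1..n}\<close>, which is the
  KL sum plus a term free of \<open>v\<close> minus the noise \<open>?B\<close>.\<close>

lemma CV_crit_diff_le:
  assumes \<phi>: "\<phi> > 0" and J: "J dvd n" "J > 0"
    and b: "\<And>i j. j \<in> {1..J} \<Longrightarrow> i \<in> {1..n} \<Longrightarrow> \<bar>b (u j i) - b (v i)\<bar> \<le> \<kappa> * d"
    and uv: "\<And>i j. j \<in> {1..J} \<Longrightarrow> i \<in> {1..n} \<Longrightarrow> \<bar>u j i - v i\<bar> \<le> d"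
  shows "\<bar>CV_crit b \<phi> n J y u - KL_loss b \<phi> n \<mu> \<eta>0 v - 2 / \<phi> * (\<Sum>i=1..n. b (\<eta>0 i) - \<mu> i * \<eta>0 i)\<bar>
    \<le> 2 / \<phi> * (real n * (\<kappa> * d) + d * (\<Sum>i=1..n. \<bar>y i\<bar>) + \<bar>\<Sum>i=1..n. (y i - \<mu> i) * v i\<bar>)"
proof -
  have ring: "k * (A + (P + Q - B)) - k * P - k * Q = k * (A - B)" for k A P Q B :: real
    by (simp add: algebra_simps)
  have fold_sub: "cv_fold n J j \<subseteq> {1..n}" if "j \<in> {1..J}" for j
  proof -
    have "(j - 1) * (n div J) + n div J = j * (n div J)"
      using that by (cases j) auto
    also have "\<dots> \<le> J * (n div J)"
      using that by (intro mult_le_mono1) auto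
    also have "\<dots> = n" using J(1) by simp
    finally show ?thesis by (auto simp: cv_fold_def)
  qed
  let ?f = "\<lambda>j i. (b (u j i) - b (v i)) - y i * (u j i - v i)"
  let ?A = "\<Sum>j=1..J. \<Sum>i\<in>cv_fold n J j. ?f j i"
  let ?B = "\<Sum>i=1..n. (y i - \<mu> i) * v i"
  have "\<bar>?A\<bar> \<le> (\<Sum>j=1..J. \<Sum>i\<in>cv_fold n J j. \<kappa> * d + d * \<bar>y i\<bar>)"
  proof (intro order_trans[OF sum_abs sum_mono] order_trans[OF sum_abs sum_mono])
    fix j i assume ji: "j \<in> {1..J}" "i \<in> cv_fold n J j"
    then have i: "i \<in> {1..n}" using fold_sub by blast
    have "\<bar>y i * (u j i - v i)\<bar> \<le> d * \<bar>y i\<bar>"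
      using mult_right_mono[OF uv[OF ji(1) i], of "\<bar>y i\<bar>"] by (simp add: abs_mult mult.commute)
    then show "\<bar>?f j i\<bar> \<le> \<kappa> * d + d * \<bar>y i\<bar>"
      using b[OF ji(1) i] by linarith
  qed
  also have "\<dots> = real n * (\<kappa> * d) + d * (\<Sum>i=1..n. \<bar>y i\<bar>)"
    unfolding sum_cv_fold[OF J] by (simp add: sum.distrib sum_distrib_left)
  finally have A: "\<bar>?A\<bar> \<le> real n * (\<kappa> * d) + d * (\<Sum>i=1..n. \<bar>y i\<bar>)" .
  have "?A = (\<Sum>j=1..J. \<Sum>i\<in>cv_fold n J j. b (u j i) - y i * u j i)
      - (\<Sum>j=1..J. \<Sum>i\<in>cv_fold n J j. b (v i) - y i * v i)"
    by (simp add: sum_subtractf[symmetric] algebra_simps)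
  then have "(\<Sum>j=1..J. \<Sum>i\<in>cv_fold n J j. b (u j i) - y i * u j i)
      = ?A + (\<Sum>i=1..n. b (v i) - y i * v i)"
    unfolding sum_cv_fold[OF J] by simp
  moreover have "(\<Sum>i=1..n. b (v i) - y i * v i)
      = (\<Sum>i=1..n. b (v i) - \<mu> i * v i - b (\<eta>0 i) + \<mu> i * \<eta>0 i)
        + (\<Sum>i=1..n. b (\<eta>0 i) - \<mu> i * \<eta>0 i) - ?B"
    unfolding sum.distrib[symmetric] sum_subtractf[symmetric]
    by (intro sum.cong) (auto simp: algebra_simps)
  ultimately have "CV_crit b \<phi> n J y u - KL_loss b \<phi> n \<mu> \<eta>0 v
      - 2 / \<phi> * (\<Sum>i=1..n. b (\<eta>0 i) - \<mu> i * \<eta>0 i) = 2 / \<phi> * (?A - ?B)"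
    unfolding CV_crit_def KL_loss_def by (simp only: ring)
  moreover have "\<bar>?A - ?B\<bar> \<le> real n * (\<kappa> * d) + d * (\<Sum>i=1..n. \<bar>y i\<bar>) + \<bar>?B\<bar>"
    using A by linarith
  ultimately show ?thesis
    using \<phi> by (simp only: abs_mult) (intro mult_mono, auto)
qed

lemma weighted_avg_mem:
  assumes "w \<in> weight_simplex S" "convex A" "\<And>s. s \<in> {1..S} \<Longrightarrow> u s \<in> A"
  shows "(\<Sum>s=1..S. w s * u s) \<in> (A :: real set)"
  using convex_sum[of "{1..S}" A w u] assms by (auto simp: weight_simplex_def)

lemma abs_weighted_avg_le:
  fixes u :: "nat \<Rightarrow> real"
  assumes "w \<in> weight_simplex S" "\<And>s. s \<in> {1..S} \<Longrightarrow> \<bar>u s\<bar> \<le> d"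
  shows "\<bar>\<Sum>s=1..S. w s * u s\<bar> \<le> d"
  using weighted_avg_mem[OF assms(1), of "{- d..d}" u] assms(2)
  by (auto simp: abs_le_iff minus_le_iff)

text \<open>Here \<open>f\<close> is the loss, \<open>g\<close> the criterion that is minimized and
  \<open>h\<close> the deterministic target of both. Minimizing \<open>g\<close> costs at most
  \<open>4 * e\<close> in \<open>f\<close>, while the infimum of \<open>f\<close> is at least half
  that of \<open>h\<close>; the quotient gives \<open>8 * \<tau>\<close>.\<close>

lemma argmin_ratio_bound:
  fixes f g h :: "'w \<Rightarrow> real"
  assumes fh: "\<And>w. w \<in> W \<Longrightarrow> \<bar>f w - h w\<bar> \<le> e" and gh: "\<And>w. w \<in> W \<Longrightarrow> \<bar>g w - h w - a\<bar> \<le> e"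
    and v: "v \<in> W" "\<And>w. w \<in> W \<Longrightarrow> g v \<le> g w"
    and h: "bdd_below (h ` W)" "0 < Inf (h ` W)"
    and e: "e \<le> \<tau> * Inf (h ` W)" and \<tau>: "0 \<le> \<tau>" "\<tau> \<le> 1 / 2"
  shows "\<bar>f v / Inf (f ` W) - 1\<bar> \<le> 8 * \<tau>"
proof -
  let ?\<xi> = "Inf (h ` W)" and ?I = "Inf (f ` W)"
  have e2: "e \<le> ?\<xi> / 2"
    using e mult_right_mono[OF \<tau>(2), of ?\<xi>] h(2) by linarith
  have low: "?\<xi> / 2 \<le> f w" if "w \<in> W" for w
    using cINF_lower[OF h(1) that] fh[OF that] e2 by linarith
  have I: "?\<xi> / 2 \<le> ?I"
    using v(1) low by (intro cINF_greatest) auto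
  have "?I \<le> f v"
    using v(1) low by (intro cINF_lower bdd_belowI2[where m = "?\<xi> / 2"]) auto
  moreover have "f v - 4 * e \<le> ?I"
  proof (rule cINF_greatest)
    fix w assume w: "w \<in> W"
    \<comment> \<open>The path is \<open>f v\<close>, \<open>h v\<close>, \<open>g v\<close>,
      \<open>g w\<close>, \<open>h w\<close>, \<open>f w\<close>: each change of function costs
      \<open>e\<close>, the middle passage is minimality, and the shift \<open>a\<close>
      cancels.\<close>
    show "f v - 4 * e \<le> f w"
      using fh[OF v(1)] gh[OF v(1)] v(2)[OF w] gh[OF w] fh[OF w] by linarith
  qed (use v in auto)
  ultimately have "\<bar>f v - ?I\<bar> \<le> 4 * e" by simp
  also have "\<dots> \<le> 8 * \<tau> * (?\<xi> / 2)" using e by simp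
  also have "\<dots> \<le> 8 * \<tau> * ?I" using I \<tau> by (intro mult_left_mono) auto
  finally have "\<bar>f v - ?I\<bar> \<le> 8 * \<tau> * ?I" .
  moreover have "?I > 0" using I h(2) by linarith
  moreover from this have "f v / ?I - 1 = (f v - ?I) / ?I" by (simp add: field_simps)
  ultimately show ?thesis by (simp add: abs_divide pos_divide_le_eq)
qed


section \<open>Asymptotic optimality\<close>

theorem theorem1:
  fixes D S R Jmax :: nat
    and p r J :: "nat \<Rightarrow> nat"
    and N :: "nat set"
    and \<nu> :: "real measure"
    and b :: "real \<Rightarrow> real" and c :: "real \<Rightarrow> real \<Rightarrow> real" and \<phi> :: real and \<Theta> :: "real set"
    and M :: "nat \<Rightarrow> 'a measure"
    and y :: "nat \<Rightarrow> nat \<Rightarrow> 'a \<Rightarrow> real"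
    and X :: "nat \<Rightarrow> nat \<Rightarrow> tensor"
    and F0 :: factors
    and \<mu> \<theta>0 :: "nat \<Rightarrow> nat \<Rightarrow> real"
    and C :: "nat \<Rightarrow> factors set"
    and Fhat :: "nat \<Rightarrow> nat \<Rightarrow> 'a \<Rightarrow> factors"
    and Fcv :: "nat \<Rightarrow> nat \<Rightarrow> nat \<Rightarrow> 'a \<Rightarrow> factors"
    and Fstar :: "nat \<Rightarrow> nat \<Rightarrow> factors"
    and what :: "nat \<Rightarrow> 'a \<Rightarrow> nat \<Rightarrow> real"
    and \<BB> :: "factors set"
    and KL CV :: "nat \<Rightarrow> 'a \<Rightarrow> (nat \<Rightarrow> real) \<Rightarrow> real"
    and KLstar :: "nat \<Rightarrow> (nat \<Rightarrow> real) \<Rightarrow> real"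
    and \<xi> :: "nat \<Rightarrow> real"
    and c0 c1 c2 c3 c4 cmin cmax :: real
  \<comment> \<open>dimensions, ranks, sample sizes and numbers of folds\<close>
  assumes dims: "1 \<le> D" "\<And>d. d < D \<Longrightarrow> 1 \<le> p d"
    and ranks: "1 \<le> S" "1 \<le> r 1" "strict_mono_on {1..S} r" "r S \<le> R"
    and sizes: "infinite N" "0 \<notin> N"
    and folds: "\<And>n. n \<in> N \<Longrightarrow> 2 \<le> J n \<and> J n \<le> Jmax \<and> J n dvd n"
  \<comment> \<open>data and true model\<close>
    and family: "\<phi> > 0" "exp_family \<nu> b c \<phi> \<Theta>"
    and prob: "\<And>n. n \<in> N \<Longrightarrow> prob_space (M n)"
    and indep: "\<And>n. n \<in> N \<Longrightarrow> prob_space.indep_vars (M n) (\<lambda>_. borel) (y n) {1..n}"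
    and \<theta>0: "\<And>n i. \<theta>0 n i = lin_pred D p (X n) (cp D R F0) i"
    and true_model: "\<And>n i. n \<in> N \<Longrightarrow> i \<in> {1..n} \<Longrightarrow> \<theta>0 n i \<in> \<Theta> \<and>
          distributed (M n) \<nu> (y n i) (\<lambda>t. ennreal (expfam_density b c \<phi> (\<theta>0 n i) t))"
    and \<mu>: "\<And>n i. \<mu> n i = (\<integral>\<omega>. y n i \<omega> \<partial>M n)"
  \<comment> \<open>candidate models, their estimators with and without a fold, and quasi-true parameters\<close>
    and constraints: "\<And>s. s \<in> {1..S} \<Longrightarrow> removes_indeterminacy D p (r s) (C s)"
    and mle: "\<And>n s \<omega>. n \<in> N \<Longrightarrow> s \<in> {1..S} \<Longrightarrow> \<omega> \<in> space (M n) \<Longrightarrow>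
          is_MLE (\<lambda>F. lin_pred D p (X n) (cp D R F)) b \<phi> {1..n} (\<lambda>i. y n i \<omega>)
            (cand_params D p R \<Theta> n (X n) (C s)) (Fhat n s \<omega>)"
    and mle_measurable: "\<And>n s d k l. n \<in> N \<Longrightarrow> s \<in> {1..S} \<Longrightarrow>
          (\<lambda>\<omega>. Fhat n s \<omega> d k l) \<in> borel_measurable (M n)"
    and mle_cv: "\<And>n j s \<omega>. n \<in> N \<Longrightarrow> j \<in> {1..J n} \<Longrightarrow> s \<in> {1..S} \<Longrightarrow> \<omega> \<in> space (M n) \<Longrightarrow>
          is_MLE (\<lambda>F. lin_pred D p (X n) (cp D R F)) b \<phi> ({1..n} - cv_fold n (J n) j)
            (\<lambda>i. y n i \<omega>) (cand_params D p R \<Theta> n (X n) (C s)) (Fcv n j s \<omega>)"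
    and mle_cv_measurable: "\<And>n j s d k l. n \<in> N \<Longrightarrow> j \<in> {1..J n} \<Longrightarrow> s \<in> {1..S} \<Longrightarrow>
          (\<lambda>\<omega>. Fcv n j s \<omega> d k l) \<in> borel_measurable (M n)"
    and quasi_true: "\<And>n s. n \<in> N \<Longrightarrow> s \<in> {1..S} \<Longrightarrow>
          is_arg_min (\<lambda>F. KL_loss b \<phi> n (\<mu> n) (\<theta>0 n) (lin_pred D p (X n) (cp D R F)))
            (\<lambda>F. F \<in> cand_params D p R \<Theta> n (X n) (C s)) (Fstar n s)"
  \<comment> \<open>losses of the averaged estimators and cross-validation weights\<close>
    and KL: "\<And>n \<omega> w. KL n \<omega> w = KL_loss b \<phi> n (\<mu> n) (\<theta>0 n)
          (lin_pred D p (X n) (tavg S w (\<lambda>s. cp D R (Fhat n s \<omega>))))"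
    and KLstar: "\<And>n w. KLstar n w = KL_loss b \<phi> n (\<mu> n) (\<theta>0 n)
          (lin_pred D p (X n) (tavg S w (\<lambda>s. cp D R (Fstar n s))))"
    and CV: "\<And>n \<omega> w. CV n \<omega> w = CV_crit b \<phi> n (J n) (\<lambda>i. y n i \<omega>)
          (\<lambda>j. lin_pred D p (X n) (tavg S w (\<lambda>s. cp D R (Fcv n j s \<omega>))))"
    and \<xi>: "\<And>n. \<xi> n = (INF w\<in>weight_simplex S. KLstar n w)"
    and weights: "\<And>n \<omega>. n \<in> N \<Longrightarrow> \<omega> \<in> space (M n) \<Longrightarrow>
          is_arg_min (CV n \<omega>) (\<lambda>w. w \<in> weight_simplex S) (what n \<omega>)"
    and weights_measurable: "\<And>n s. n \<in> N \<Longrightarrow> s \<in> {1..S} \<Longrightarrow>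
          (\<lambda>\<omega>. what n \<omega> s) \<in> borel_measurable (M n)"
  \<comment> \<open>consistency and regularity conditions; the rate is that of the estimator of the \<open>s\<close>-th model, on the full and on the fold-deleted data\<close>
    and cond_a_compact: "\<BB> \<subseteq> factor_space D p R" "compact \<BB>"
    and cond_a_interior: "\<And>n s. n \<in> N \<Longrightarrow> s \<in> {1..S} \<Longrightarrow>
          Fstar n s \<in> top_of_set (factor_space D p R) interior_of \<BB>"
        "F0 \<in> top_of_set (factor_space D p R) interior_of \<BB>"
    and cond_a_rate: "\<And>s. s \<in> {1..S} \<Longrightarrow>
          bigO_prob (along N) M (\<lambda>n \<omega>. factor_dist D p R (Fhat n s \<omega>) (Fstar n s))
            (\<lambda>n. real n powr (-1/2))"
    and cond_a_rate_cv: "\<And>s. s \<in> {1..S} \<Longrightarrow>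
          bigO_prob (along N) M
            (\<lambda>n \<omega>. MAX j\<in>{1..J n}. factor_dist D p R (Fcv n j s \<omega>) (Fstar n s))
            (\<lambda>n. real n powr (-1/2))"
    and cond_b: "\<And>n i F. n \<in> N \<Longrightarrow> i \<in> {1..n} \<Longrightarrow> F \<in> \<BB> \<Longrightarrow>
          grad_norm D p R (\<lambda>G. lin_pred D p (X n) (cp D R G) i) F \<le> c0"
    and cond_c: "c1 > 0" "c2 > 0"
        "\<And>n. n \<in> N \<Longrightarrow> (\<Sum>i=1..n. (\<mu> n i)\<^sup>2) / real n \<le> c1"
        "\<And>n i. n \<in> N \<Longrightarrow> i \<in> {1..n} \<Longrightarrow> tnorm D p (X n i) \<le> c2"
    and cond_d: "cmin > 0"
        "\<forall>\<^sub>F n in along N. cmin \<le> lambda_min (gram_mat D p n (X n)) \<and>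
           lambda_max (gram_mat D p n (X n)) \<le> cmax"
    and cond_e: "\<And>n i F. n \<in> N \<Longrightarrow> i \<in> {1..n} \<Longrightarrow> F \<in> \<BB> \<Longrightarrow> lin_pred D p (X n) (cp D R F) i \<in> \<Theta>"
        "\<And>n i F k. n \<in> N \<Longrightarrow> i \<in> {1..n} \<Longrightarrow> F \<in> \<BB> \<Longrightarrow> k \<in> {1, 2} \<Longrightarrow>
           \<bar>(deriv ^^ k) b (lin_pred D p (X n) (cp D R F) i)\<bar> \<le> c3"
        "c4 > 0"
        "\<And>n i F. n \<in> N \<Longrightarrow> i \<in> {1..n} \<Longrightarrow> F \<in> \<BB> \<Longrightarrow>
           c4 \<le> (deriv ^^ 2) b (lin_pred D p (X n) (cp D R F) i)"
  \<comment> \<open>positivity of \<open>\<xi> n\<close> is needed because division by zero yields zero\<close>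
    and cond_f: "\<forall>\<^sub>F n in along N. \<xi> n > 0" "((\<lambda>n. real n / (\<xi> n)\<^sup>2) \<longlongrightarrow> 0) (along N)"
  shows "tendsto_prob (along N) M
           (\<lambda>n \<omega>. KL n \<omega> (what n \<omega>) / (INF w\<in>weight_simplex S. KL n \<omega> w)) 1"
proof -

  \<comment> \<open>Natural parameters at factors from the compact set\<close>
  let ?W = "weight_simplex S"
  define \<eta> where "\<eta> n F i = lin_pred D p (X n) (cp D R F) i" for n F i
  have n_pos: "n > 0" if "n \<in> N" for n
    using that sizes(2) by (metis gr0I)
  have \<Theta>: "open \<Theta>" "convex \<Theta>" "is_interval \<Theta>"
    using family(2) by (auto simp: exp_family_def is_interval_convex_1)
  have tangent: "b u + deriv b u * (v - u) \<le> b v" if "u \<in> \<Theta>" "v \<in> \<Theta>" for u v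
    using expfam_tangent_le[OF family(2,1) that] .
  have Fstar_mem: "Fstar n s \<in> \<BB>" if "n \<in> N" "s \<in> {1..S}" for n s
    using cond_a_interior(1)[OF that] by (rule subsetD[OF interior_of_subset])
  have F0_mem: "F0 \<in> \<BB>"
    using cond_a_interior(2) by (rule subsetD[OF interior_of_subset])
  obtain L where L: "0 \<le> L"
    "\<And>X i F. tnorm D p (X i) \<le> c2 \<Longrightarrow> F \<in> \<BB> \<Longrightarrow> \<bar>lin_pred D p X (cp D R F) i\<bar> \<le> L"
    "\<And>X i F G. tnorm D p (X i) \<le> c2 \<Longrightarrow> F \<in> \<BB> \<Longrightarrow> factor_dist D p R G F \<le> 1 \<Longrightarrow>
       \<bar>lin_pred D p X (cp D R G) i - lin_pred D p X (cp D R F) i\<bar> \<le> L * factor_dist D p R G F"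
    using lin_pred_cp_lipschitz[where p = p and D = D and R = R and C = c2,
        OF cond_a_compact(2) dims(2) less_imp_le[OF cond_c(2)]] by blast
  have \<eta>_bound: "\<bar>\<eta> n F i\<bar> \<le> L" if "n \<in> N" "i \<in> {1..n}" "F \<in> \<BB>" for n i F
    unfolding \<eta>_def by (rule L(2)) (use cond_c(4) that in auto)
  have \<eta>_lipschitz: "\<bar>\<eta> n G i - \<eta> n F i\<bar> \<le> L * factor_dist D p R G F"
    if "n \<in> N" "i \<in> {1..n}" "F \<in> \<BB>" "factor_dist D p R G F \<le> 1" for n i F G
    unfolding \<eta>_def by (rule L(3)) (use cond_c(4) that in auto)

  \<comment> \<open>Lipschitz continuity of \<open>b\<close> near the hull of these
    parameters\<close>
  define T where "T = {\<eta> n F i | n F i. n \<in> N \<and> i \<in> {1..n} \<and> F \<in> \<BB>}"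
  have T_mem: "\<eta> n F i \<in> T" if "n \<in> N" "i \<in> {1..n}" "F \<in> \<BB>" for n i F
    using that unfolding T_def by blast
  have T_\<Theta>: "T \<subseteq> \<Theta>" unfolding T_def \<eta>_def using cond_e(1) by blast
  have "T \<noteq> {}"
  proof -
    obtain n where "n \<in> N" using sizes(1) by (metis ex_in_conv finite.emptyI)
    then show ?thesis using T_mem[of n 1 F0] F0_mem n_pos[of n] by auto
  qed
  have "bounded T"
    unfolding bounded_iff by (rule exI[of _ L]) (use \<eta>_bound in \<open>auto simp: T_def\<close>)
  have T_deriv: "\<bar>deriv b t\<bar> \<le> c3" if "t \<in> T" for t
    using that cond_e(2)[where k = 1] by (auto simp: T_def \<eta>_def)
  define H where "H = convex hull T"
  have mono: "mono_on \<Theta> (deriv b)" by (rule tangent_imp_mono_on[OF tangent])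
  \<comment> \<open>As \<open>deriv b\<close> is monotone on the interval \<open>\<Theta>\<close>, a
    bound at two points holds between them; the hull \<open>H\<close> thus inherits the bound known
    on \<open>T\<close>.\<close>
  have "convex {t \<in> \<Theta>. \<bar>deriv b t\<bar> \<le> c3}"
  proof -
    have "is_interval {t \<in> \<Theta>. \<bar>deriv b t\<bar> \<le> c3}"
      unfolding is_interval_1
    proof (intro ballI allI impI)
      fix u v t assume uv: "u \<in> {t \<in> \<Theta>. \<bar>deriv b t\<bar> \<le> c3}" "v \<in> {t \<in> \<Theta>. \<bar>deriv b t\<bar> \<le> c3}"
        and t: "u \<le> t \<and> t \<le> v"
      have t\<Theta>: "t \<in> \<Theta>" using \<Theta>(3) uv t unfolding is_interval_1 by blast
      have "deriv b u \<le> deriv b t" "deriv b t \<le> deriv b v"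
        using mono uv t t\<Theta> by (auto intro: mono_onD)
      then show "t \<in> {t \<in> \<Theta>. \<bar>deriv b t\<bar> \<le> c3}" using uv t\<Theta> by auto
    qed
    then show ?thesis by (rule is_interval_convex)
  qed
  then have H_sub: "H \<subseteq> {t \<in> \<Theta>. \<bar>deriv b t\<bar> \<le> c3}"
    unfolding H_def using T_\<Theta> T_deriv by (intro hull_minimal) auto
  have "H \<noteq> {}" "bounded H"
    using \<open>T \<noteq> {}\<close> \<open>bounded T\<close> by (auto simp: H_def bounded_convex_hull)
  \<comment> \<open>Averages of quasi-true parameters lie in \<open>H\<close>, but averaged
    estimates are only known to be in \<open>\<Theta>\<close> and close to \<open>H\<close>, so the
    slope bound has to reach \<open>\<delta>\<close> beyond \<open>H\<close>.\<close>
  obtain \<delta> \<kappa> where \<delta>: "\<delta> > 0" "\<kappa> \<ge> 0"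
    "\<And>\<theta> t. \<theta> \<in> \<Theta> \<Longrightarrow> t \<in> H \<Longrightarrow> \<bar>\<theta> - t\<bar> \<le> \<delta> \<Longrightarrow> \<bar>deriv b \<theta>\<bar> \<le> \<kappa>"
    using mono_abs_bounded_near[OF \<Theta>(1,3) _ \<open>H \<noteq> {}\<close> \<open>bounded H\<close> mono, of c3] H_sub by blast
  have b_lipschitz: "\<bar>b u - b t\<bar> \<le> \<kappa> * \<bar>u - t\<bar>" if "u \<in> \<Theta>" "t \<in> H" "\<bar>u - t\<bar> \<le> \<delta>" for u t
  proof (rule convex_deriv_lipschitz[where \<Theta> = \<Theta>, OF tangent])
    show "t \<in> \<Theta>" using H_sub that by auto
    show "\<bar>deriv b u\<bar> \<le> \<kappa>" by (rule \<delta>(3)[OF that])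
    show "\<bar>deriv b t\<bar> \<le> \<kappa>" using \<open>t \<in> \<Theta>\<close> that(2) \<delta>(1) by (intro \<delta>(3)[of t t]) auto
  qed (use that in auto)

  \<comment> \<open>Mean and variance of the responses\<close>
  have \<theta>0_T: "\<theta>0 n i \<in> T" if "n \<in> N" "i \<in> {1..n}" for n i
    using T_mem[OF that F0_mem] by (simp add: \<theta>0 \<eta>_def)
  note y_moments = distributed_expfam_moments[OF family(2,1) conjunct1[OF true_model] conjunct2[OF true_model]]
  have \<mu>_eq: "\<mu> n i = deriv b (\<theta>0 n i)" if "n \<in> N" "i \<in> {1..n}" for n i
    unfolding \<mu> by (rule y_moments(2)[OF that that])
  have \<mu>_bound: "\<bar>\<mu> n i\<bar> \<le> c3" if "n \<in> N" "i \<in> {1..n}" for n i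
    unfolding \<mu>_eq[OF that] by (rule T_deriv[OF \<theta>0_T[OF that]])
  have y_int: "integrable (M n) (y n i)" "integrable (M n) (\<lambda>\<omega>. (y n i \<omega>)\<^sup>2)"
    if "n \<in> N" "i \<in> {1..n}" for n i
    using y_moments(1)[OF that that, of 1] y_moments(1)[OF that that, of 2] by auto
  have y_centred: "integrable (M n) (\<lambda>\<omega>. (y n i \<omega> - \<mu> n i)\<^sup>2)"
    "(\<integral>\<omega>. y n i \<omega> - \<mu> n i \<partial>M n) = 0" "(\<integral>\<omega>. (y n i \<omega> - \<mu> n i)\<^sup>2 \<partial>M n) \<le> \<phi> * c3"
    if ni: "n \<in> N" "i \<in> {1..n}" for n i
  proof -
    interpret prob_space "M n" by (rule prob[OF ni(1)])
    show "integrable (M n) (\<lambda>\<omega>. (y n i \<omega> - \<mu> n i)\<^sup>2)"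
      using y_int[OF ni] by (simp add: power2_diff)
    show "(\<integral>\<omega>. y n i \<omega> - \<mu> n i \<partial>M n) = 0"
      using y_int(1)[OF ni] by (simp add: \<mu> prob_space)
    have "\<bar>(deriv ^^ 2) b (\<theta>0 n i)\<bar> \<le> c3"
      unfolding \<theta>0 by (rule cond_e(2)[OF ni F0_mem]) simp
    then show "(\<integral>\<omega>. (y n i \<omega> - \<mu> n i)\<^sup>2 \<partial>M n) \<le> \<phi> * c3"
      unfolding \<mu>_eq[OF ni] y_moments(3)[OF ni ni] using family(1) by (intro mult_left_mono) auto
  qed

  \<comment> \<open>Normalized random error terms\<close>
  define r0 where "r0 n = real n powr (-1/2)" for n :: nat
  have r0: "r0 n = 1 / sqrt (real n)" if "n > 0" for n
  proof -
    have "(-1/2 :: real) = - (1/2)" by simp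
    then show ?thesis
      unfolding r0_def using that by (simp only: powr_minus_divide) (simp add: powr_half_sqrt)
  qed
  \<comment> \<open>The noise along a weighted average of quasi-true parameters is the same weighted
    average of these sums, so uniformity in the weights reduces to finitely many
    \<open>s\<close>.\<close>
  define lin where "lin s n \<omega> = (\<Sum>i=1..n. (y n i \<omega> - \<mu> n i) * \<eta> n (Fstar n s) i)" for s n \<omega>
  define Z1 where "Z1 s n \<omega> = factor_dist D p R (Fhat n s \<omega>) (Fstar n s) / r0 n" for s n \<omega>
  define Z2 where
    "Z2 s n \<omega> = (MAX j\<in>{1..J n}. factor_dist D p R (Fcv n j s \<omega>) (Fstar n s)) / r0 n" for s n \<omega>
  define Z3 where "Z3 s n \<omega> = lin s n \<omega> / sqrt (real n)" for s n \<omega>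
  \<comment> \<open>Controls the sum of the absolute responses, which multiplies the error of the
    predictors in the cross-validation criterion.\<close>
  define Z4 where "Z4 n \<omega> = (\<Sum>i=1..n. (y n i \<omega> - \<mu> n i)\<^sup>2) / real n" for n \<omega>
  \<comment> \<open>A bound on this sum bounds every error term at once, so one exceptional set
    serves them all.\<close>
  define Z where "Z n \<omega> = (\<Sum>s=1..S. \<bar>Z1 s n \<omega>\<bar> + \<bar>Z2 s n \<omega>\<bar> + \<bar>Z3 s n \<omega>\<bar>) + \<bar>Z4 n \<omega>\<bar>" for n \<omega>

  \<comment> \<open>Boundedness in probability of the error terms\<close>
  have Z1: "bounded_in_prob (along N) M (Z1 s)" if s: "s \<in> {1..S}" for s
    unfolding Z1_def[abs_def] r0_def
  proof (rule bigO_prob_imp_bounded_in_prob[OF cond_a_rate[OF s]], use eventually_along_mem in eventually_elim)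
    case (elim n)
    have "(\<lambda>\<omega>. factor_dist D p R (Fhat n s \<omega>) (Fstar n s)) \<in> borel_measurable (M n)"
      unfolding factor_dist_def using mle_measurable[OF elim s] by measurable
    then show ?case using n_pos[OF elim] by simp
  qed
  have Z2: "bounded_in_prob (along N) M (Z2 s)" if s: "s \<in> {1..S}" for s
    unfolding Z2_def[abs_def] r0_def
  proof (rule bigO_prob_imp_bounded_in_prob[OF cond_a_rate_cv[OF s]], use eventually_along_mem in eventually_elim)
    case (elim n)
    have "(\<lambda>\<omega>. factor_dist D p R (Fcv n j s \<omega>) (Fstar n s)) \<in> borel_measurable (M n)"
      if "j \<in> {1..J n}" for j
      unfolding factor_dist_def using mle_cv_measurable[OF elim that s] by measurable
    then have "(\<lambda>\<omega>. MAX j\<in>{1..J n}. factor_dist D p R (Fcv n j s \<omega>) (Fstar n s)) \<in> borel_measurable (M n)"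
      by (intro borel_measurable_Max) auto
    then show ?case using n_pos[OF elim] by simp
  qed
  have Z3: "bounded_in_prob (along N) M (Z3 s)" if s: "s \<in> {1..S}" for s
  proof -
    \<comment> \<open>The square has bounded mean, its summands being independent and centred with
      variance at most \<open>\<phi> * c3\<close> times a squared predictor. It dominates
      \<open>Z3 s\<close> itself through
      \<open>2 * \<bar>z\<bar> \<le> 1 + z\<^sup>2\<close>.\<close>
    have "bounded_in_prob (along N) M (\<lambda>n \<omega>. (Z3 s n \<omega>)\<^sup>2)"
    proof (rule bounded_in_prob_expectation[where C = "L\<^sup>2 * (\<phi> * c3)"], use eventually_along_mem in eventually_elim)
      case (elim n)
      interpret prob_space "M n" by (rule prob[OF elim])
      let ?t = "\<lambda>i \<omega>. (y n i \<omega> - \<mu> n i) * \<eta> n (Fstar n s) i"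
      have ind: "indep_vars (\<lambda>_. borel) ?t {1..n}"
        by (rule indep_vars_compose2[OF indep[OF elim], of "\<lambda>i t. (t - \<mu> n i) * \<eta> n (Fstar n s) i"]) auto
      have int: "integrable (M n) (\<lambda>\<omega>. (?t i \<omega>)\<^sup>2)" if "i \<in> {1..n}" for i
        using y_centred(1)[OF elim that] by (simp add: power_mult_distrib)
      have mean: "expectation (?t i) = 0" if "i \<in> {1..n}" for i
        using y_centred(2)[OF elim that] by simp
      have second: "integrable (M n) (\<lambda>\<omega>. (lin s n \<omega>)\<^sup>2)"
          "expectation (\<lambda>\<omega>. (lin s n \<omega>)\<^sup>2) = (\<Sum>i=1..n. expectation (\<lambda>\<omega>. (?t i \<omega>)\<^sup>2))"
        unfolding lin_def by (rule second_moment_sum_indep[OF finite_atLeastAtMost ind int mean], assumption+)+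
      have "expectation (\<lambda>\<omega>. (?t i \<omega>)\<^sup>2) \<le> \<phi> * c3 * L\<^sup>2" if i: "i \<in> {1..n}" for i
      proof -
        have "(\<eta> n (Fstar n s) i)\<^sup>2 \<le> L\<^sup>2"
          using power_mono[OF \<eta>_bound[OF elim i Fstar_mem[OF elim s]], of 2] by simp
        \<comment> \<open>The sign comes from the variance, which this product bounds above.\<close>
        moreover have "0 \<le> \<phi> * c3"
          by (rule order_trans[OF _ y_centred(3)[OF elim i]]) simp
        ultimately show ?thesis
          unfolding power_mult_distrib
          using y_centred(3)[OF elim i] by (simp, intro mult_mono) auto
      qed
      then have "(\<Sum>i=1..n. expectation (\<lambda>\<omega>. (?t i \<omega>)\<^sup>2)) \<le> (\<Sum>i=1..n. \<phi> * c3 * L\<^sup>2)"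
        by (rule sum_mono)
      then have "expectation (\<lambda>\<omega>. (lin s n \<omega>)\<^sup>2) \<le> real n * (L\<^sup>2 * (\<phi> * c3))"
        unfolding second(2) by (simp add: mult_ac)
      then show ?case
        using second(1) n_pos[OF elim]
        by (simp add: Z3_def power_divide pos_divide_le_eq mult.commute)
    qed
    then show ?thesis
    proof (rule bounded_in_prob_dominated[where C = 1], intro always_eventually allI ballI)
      fix n \<omega>
      have "0 \<le> (\<bar>Z3 s n \<omega>\<bar> - 1)\<^sup>2" by simp
      then have "2 * \<bar>Z3 s n \<omega>\<bar> \<le> 1 + (Z3 s n \<omega>)\<^sup>2" by (simp add: power2_diff)
      then show "\<bar>Z3 s n \<omega>\<bar> \<le> 1 + \<bar>(Z3 s n \<omega>)\<^sup>2\<bar>" by simp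
    qed
  qed
  have Z4: "bounded_in_prob (along N) M Z4"
  proof (rule bounded_in_prob_expectation[where C = "\<phi> * c3"], use eventually_along_mem in eventually_elim)
    case (elim n)
    have "(\<integral>\<omega>. (\<Sum>i=1..n. (y n i \<omega> - \<mu> n i)\<^sup>2) \<partial>M n) = (\<Sum>i=1..n. \<integral>\<omega>. (y n i \<omega> - \<mu> n i)\<^sup>2 \<partial>M n)"
      using y_centred(1)[OF elim] by (intro Bochner_Integration.integral_sum) auto
    also have "\<dots> \<le> (\<Sum>i=1..n. \<phi> * c3)"
      by (intro sum_mono y_centred(3)[OF elim])
    finally have "(\<integral>\<omega>. (\<Sum>i=1..n. (y n i \<omega> - \<mu> n i)\<^sup>2) \<partial>M n) \<le> \<phi> * c3 * real n"
      by (simp add: mult.commute)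
    moreover have "integrable (M n) (\<lambda>\<omega>. \<Sum>i=1..n. (y n i \<omega> - \<mu> n i)\<^sup>2)"
      using y_centred(1)[OF elim] by (intro Bochner_Integration.integrable_sum) auto
    ultimately show ?case
      using n_pos[OF elim] by (auto simp: Z4_def[abs_def] pos_divide_le_eq sum_nonneg)
  qed
  have Z: "bounded_in_prob (along N) M Z"
    unfolding Z_def[abs_def] using Z1 Z2 Z3 Z4
    by (intro bounded_in_prob_add bounded_in_prob_sum bounded_in_prob_abs) auto

  \<comment> \<open>Deterministic comparison of the criteria where \<open>Z\<close> is
    bounded\<close>
  define err where "err K = 2 / \<phi> * (L * K * (\<kappa> + c3) + L * K * \<kappa> + L * K * (1 + c3 + K) + K)" for K
  \<comment> \<open>The assumptions \<open>large\<close> keep the estimates within distance one of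
    the quasi-true factors and the averaged predictors within \<open>\<delta>\<close> of
    \<open>H\<close>. The product \<open>err K * sqrt (real n)\<close> bounds the errors of both the
    loss and the criterion.\<close>
  have core: "\<bar>KL n \<omega> (what n \<omega>) / (INF w\<in>?W. KL n \<omega> w) - 1\<bar> \<le> 8 * \<tau>"
    if n: "n \<in> N" and \<omega>: "\<omega> \<in> space (M n)" and ZK: "\<bar>Z n \<omega>\<bar> \<le> K" and \<tau>: "0 \<le> \<tau>" "\<tau> \<le> 1 / 2"
      and large: "K \<le> sqrt (real n)" "L * K \<le> \<delta> * sqrt (real n)"
      and \<xi>_pos: "\<xi> n > 0" and err_le: "err K * sqrt (real n) \<le> \<tau> * \<xi> n" for n \<omega> K \<tau>
  proof -
    have n0: "real n > 0" using n_pos[OF n] by simp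
    define q where "q = sqrt (real n)"
    have q: "q > 0" "real n = q * q" using n0 by (auto simp: q_def)
    have r0n: "r0 n = 1 / q" using r0[OF n_pos[OF n]] by (simp add: q_def)
    have Z_nonneg: "0 \<le> (\<Sum>s=1..S. \<bar>Z1 s n \<omega>\<bar> + \<bar>Z2 s n \<omega>\<bar> + \<bar>Z3 s n \<omega>\<bar>)"
      by (intro sum_nonneg) auto
    have K0: "0 \<le> K" using ZK by linarith
    have Zs: "\<bar>Z1 s n \<omega>\<bar> + \<bar>Z2 s n \<omega>\<bar> + \<bar>Z3 s n \<omega>\<bar> \<le> K" if "s \<in> {1..S}" for s
    proof -
      have "\<bar>Z1 s n \<omega>\<bar> + \<bar>Z2 s n \<omega>\<bar> + \<bar>Z3 s n \<omega>\<bar> \<le> (\<Sum>s=1..S. \<bar>Z1 s n \<omega>\<bar> + \<bar>Z2 s n \<omega>\<bar> + \<bar>Z3 s n \<omega>\<bar>)"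
        using that by (intro member_le_sum) auto
      then show ?thesis using ZK Z_nonneg unfolding Z_def by linarith
    qed
    have Z4K: "Z4 n \<omega> \<le> K" using ZK Z_nonneg unfolding Z_def by linarith
    have dist_hat: "factor_dist D p R (Fhat n s \<omega>) (Fstar n s) \<le> K / q" if "s \<in> {1..S}" for s
    proof -
      have "Z1 s n \<omega> \<le> K" using Zs[OF that] by linarith
      then show ?thesis using q by (simp add: Z1_def r0n field_simps)
    qed
    have dist_cv: "factor_dist D p R (Fcv n j s \<omega>) (Fstar n s) \<le> K / q"
      if "s \<in> {1..S}" "j \<in> {1..J n}" for s j
    proof -
      have "factor_dist D p R (Fcv n j s \<omega>) (Fstar n s)
          \<le> (MAX j\<in>{1..J n}. factor_dist D p R (Fcv n j s \<omega>) (Fstar n s))"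
        using that by (intro Max_ge) auto
      also have "\<dots> \<le> K / q"
      proof -
        have "Z2 s n \<omega> \<le> K" using Zs[OF that(1)] by linarith
        then show ?thesis using q by (simp add: Z2_def r0n field_simps)
      qed
      finally show ?thesis .
    qed
    have lin_le: "\<bar>lin s n \<omega>\<bar> \<le> K * q" if "s \<in> {1..S}" for s
    proof -
      have "\<bar>Z3 s n \<omega>\<bar> \<le> K" using Zs[OF that] by linarith
      then show ?thesis using q by (simp add: Z3_def q_def[symmetric] abs_divide pos_divide_le_eq)
    qed
    \<comment> \<open>Lipschitz constant times the factor distance \<open>K / q\<close>; summed over
      the \<open>n\<close> observations, this error is of order \<open>q\<close>.\<close>
    define d where "d = L * K / q"
    have d: "0 \<le> d" "d \<le> \<delta>" "real n * d = L * K * q"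
      using L(1) K0 q large by (auto simp: d_def pos_divide_le_eq q_def[symmetric])
    define \<eta>s where "\<eta>s w i = lin_pred D p (X n) (tavg S w (\<lambda>s. cp D R (Fstar n s))) i" for w i
    have \<eta>s_eq: "\<eta>s w i = (\<Sum>s=1..S. w s * \<eta> n (Fstar n s) i)" for w i
      by (simp add: \<eta>s_def lin_pred_tavg \<eta>_def)
    have \<eta>s_H: "\<eta>s w i \<in> H" if "w \<in> ?W" "i \<in> {1..n}" for w i
      unfolding \<eta>s_eq H_def using that T_mem[OF n] Fstar_mem[OF n]
      by (intro weighted_avg_mem hull_inc convex_convex_hull) auto
    \<comment> \<open>Stated for arbitrary \<open>G\<close> to cover estimates with and without a
      fold. Membership in \<open>\<Theta>\<close> follows by convexity, since
      \<open>cand_params\<close> demands admissibility at all \<open>n\<close> observations,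
      held-out ones included.\<close>
    have avg: "lin_pred D p (X n) (tavg S w (\<lambda>s. cp D R (G s))) i \<in> \<Theta>"
      "\<bar>lin_pred D p (X n) (tavg S w (\<lambda>s. cp D R (G s))) i - \<eta>s w i\<bar> \<le> d"
      "\<bar>b (lin_pred D p (X n) (tavg S w (\<lambda>s. cp D R (G s))) i) - b (\<eta>s w i)\<bar> \<le> \<kappa> * d"
      if w: "w \<in> ?W" and i: "i \<in> {1..n}"
        and G: "\<And>s. s \<in> {1..S} \<Longrightarrow> G s \<in> cand_params D p R \<Theta> n (X n) (C s)"
        "\<And>s. s \<in> {1..S} \<Longrightarrow> factor_dist D p R (G s) (Fstar n s) \<le> K / q" for w i G
    proof -
      let ?u = "lin_pred D p (X n) (tavg S w (\<lambda>s. cp D R (G s))) i"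
      have u: "?u = (\<Sum>s=1..S. w s * \<eta> n (G s) i)"
        by (simp add: lin_pred_tavg \<eta>_def)
      show u\<Theta>: "?u \<in> \<Theta>"
        unfolding u by (rule weighted_avg_mem[OF w \<Theta>(2)]) (use G(1) i in \<open>auto simp: cand_params_def \<eta>_def\<close>)
      have "\<bar>\<eta> n (G s) i - \<eta> n (Fstar n s) i\<bar> \<le> d" if s: "s \<in> {1..S}" for s
      proof -
        have "K / q \<le> 1" using large(1) q by (simp add: q_def[symmetric])
        then have "\<bar>\<eta> n (G s) i - \<eta> n (Fstar n s) i\<bar> \<le> L * factor_dist D p R (G s) (Fstar n s)"
          using \<eta>_lipschitz[OF n i Fstar_mem[OF n s], of "G s"] G(2)[OF s] by linarith
        also have "\<dots> \<le> d"
          unfolding d_def using mult_left_mono[OF G(2)[OF s] L(1)] by simp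
        finally show ?thesis .
      qed
      from abs_weighted_avg_le[OF w this]
      show ud: "\<bar>?u - \<eta>s w i\<bar> \<le> d"
        by (simp add: u \<eta>s_eq sum_subtractf right_diff_distrib)
      have "\<bar>b ?u - b (\<eta>s w i)\<bar> \<le> \<kappa> * \<bar>?u - \<eta>s w i\<bar>"
        using ud d(2) by (intro b_lipschitz[OF u\<Theta> \<eta>s_H[OF w i]]) simp
      also have "\<dots> \<le> \<kappa> * d" using ud \<delta>(2) by (rule mult_left_mono)
      finally show "\<bar>b ?u - b (\<eta>s w i)\<bar> \<le> \<kappa> * d" .
    qed
    have hat_mem: "Fhat n s \<omega> \<in> cand_params D p R \<Theta> n (X n) (C s)" if "s \<in> {1..S}" for s
      using mle[OF n that \<omega>] by (simp add: is_MLE_def)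
    have cv_mem: "Fcv n j s \<omega> \<in> cand_params D p R \<Theta> n (X n) (C s)"
      if "s \<in> {1..S}" "j \<in> {1..J n}" for s j
      using mle_cv[OF n that(2,1) \<omega>] by (simp add: is_MLE_def)
    have KLstar_eq: "KLstar n w = KL_loss b \<phi> n (\<mu> n) (\<theta>0 n) (\<eta>s w)" for w
      unfolding KLstar \<eta>s_def[abs_def] ..
    have c3: "0 \<le> c3" using \<mu>_bound[OF n, of 1] n_pos[OF n] by force

    have KL_close: "\<bar>KL n \<omega> w - KLstar n w\<bar> \<le> err K * q" if w: "w \<in> ?W" for w
    proof -
      have "\<bar>KL n \<omega> w - KLstar n w\<bar> \<le> 2 / \<phi> * (real n * ((\<kappa> + c3) * d))"
        unfolding KL KLstar_eq
        by (intro KL_loss_diff_le family(1) avg(2,3) w hat_mem dist_hat \<mu>_bound n)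
      also have "real n * ((\<kappa> + c3) * d) = (\<kappa> + c3) * (real n * d)" by (simp add: mult_ac)
      \<comment> \<open>The first summand of \<open>err\<close> covers this error; the remaining
        ones are nonnegative.\<close>
      also have "2 / \<phi> * \<dots> \<le> err K * q"
        unfolding d(3) err_def mult.assoc[of "2 / \<phi>"] using family(1) q L(1) K0 \<delta>(2) c3
        by (intro mult_left_mono) (auto simp: algebra_simps)
      finally show ?thesis .
    qed

    \<comment> \<open>The weight-free part of the criterion, which does not influence the
      minimizer.\<close>
    define a where "a = 2 / \<phi> * (\<Sum>i=1..n. b (\<theta>0 n i) - \<mu> n i * \<theta>0 n i)"
    have CV_close: "\<bar>CV n \<omega> w - KLstar n w - a\<bar> \<le> err K * q" if w: "w \<in> ?W" for w
    proof -
      \<comment> \<open>By \<open>\<bar>t\<bar> \<le> 1 + t\<^sup>2\<close> the absolute responses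
        reduce to the bound on the means and the squared noise collected in
        \<open>Z4\<close>.\<close>
      have y_le: "(\<Sum>i=1..n. \<bar>y n i \<omega>\<bar>) \<le> real n * (1 + c3 + K)"
      proof -
        have "(\<Sum>i=1..n. \<bar>y n i \<omega>\<bar>) \<le> (\<Sum>i=1..n. (1 + c3) + (y n i \<omega> - \<mu> n i)\<^sup>2)"
        proof (rule sum_mono)
          fix i assume i: "i \<in> {1..n}"
          have abs_le: "\<bar>t\<bar> \<le> 1 + t\<^sup>2" for t :: real
            using zero_le_power2[of "\<bar>t\<bar> - 1"] by (simp add: power2_diff)
          have "\<bar>y n i \<omega>\<bar> \<le> \<bar>\<mu> n i\<bar> + \<bar>y n i \<omega> - \<mu> n i\<bar>" by linarith
          also have "\<dots> \<le> c3 + (1 + (y n i \<omega> - \<mu> n i)\<^sup>2)"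
            by (intro add_mono \<mu>_bound[OF n i] abs_le)
          finally show "\<bar>y n i \<omega>\<bar> \<le> (1 + c3) + (y n i \<omega> - \<mu> n i)\<^sup>2" by simp
        qed
        also have "\<dots> = real n * (1 + c3) + real n * Z4 n \<omega>"
          using n0 by (simp add: sum.distrib Z4_def)
        also have "\<dots> \<le> real n * (1 + c3) + real n * K"
          using Z4K by (intro add_left_mono mult_left_mono) auto
        finally show ?thesis by (simp add: algebra_simps)
      qed
      have "(\<Sum>i=1..n. (y n i \<omega> - \<mu> n i) * \<eta>s w i) = (\<Sum>s=1..S. w s * lin s n \<omega>)"
        unfolding \<eta>s_eq lin_def sum_distrib_left by (subst sum.swap) (simp add: mult_ac)
      then have lin_w: "\<bar>\<Sum>i=1..n. (y n i \<omega> - \<mu> n i) * \<eta>s w i\<bar> \<le> K * q"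
        using abs_weighted_avg_le[OF w lin_le] by simp
      have J: "J n dvd n" "J n > 0" using folds[OF n] by auto
      have "\<bar>CV n \<omega> w - KLstar n w - a\<bar> \<le> 2 / \<phi> * (real n * (\<kappa> * d) + d * (\<Sum>i=1..n. \<bar>y n i \<omega>\<bar>)
          + \<bar>\<Sum>i=1..n. (y n i \<omega> - \<mu> n i) * \<eta>s w i\<bar>)"
        unfolding CV KLstar_eq a_def
        by (intro CV_crit_diff_le family(1) J avg(2,3) w cv_mem dist_cv)
      also have "\<dots> \<le> 2 / \<phi> * (real n * (\<kappa> * d) + d * (real n * (1 + c3 + K)) + K * q)"
        using family(1) y_le lin_w d(1) \<delta>(2) by (intro mult_left_mono add_mono) auto
      also have "real n * (\<kappa> * d) + d * (real n * (1 + c3 + K)) + K * q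
          = \<kappa> * (real n * d) + (real n * d) * (1 + c3 + K) + K * q" by (simp add: algebra_simps)
      \<comment> \<open>The last three summands of \<open>err\<close> cover, in this order, the
        change in \<open>b\<close>, the term with the responses, and the noise.\<close>
      also have "2 / \<phi> * \<dots> \<le> err K * q"
        unfolding d(3) err_def mult.assoc[of "2 / \<phi>"] using family(1) q L(1) K0 \<delta>(2) c3
        by (intro mult_left_mono) (auto simp: algebra_simps)
      finally show ?thesis .
    qed

    \<comment> \<open>Provides the lower bound without which the infimum of \<open>KLstar n\<close>
      would carry no information.\<close>
    have KLstar_nonneg: "0 \<le> KLstar n w" if w: "w \<in> ?W" for w
      unfolding KLstar_eq
    proof (rule KL_loss_nonneg[OF family(1)])
      fix i assume i: "i \<in> {1..n}"
      show "b (\<theta>0 n i) + \<mu> n i * (\<eta>s w i - \<theta>0 n i) \<le> b (\<eta>s w i)"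
        unfolding \<mu>_eq[OF n i] using \<theta>0_T[OF n i] T_\<Theta> \<eta>s_H[OF w i] H_sub by (intro tangent) auto
    qed
    have what: "what n \<omega> \<in> ?W" "CV n \<omega> (what n \<omega>) \<le> CV n \<omega> w" if "w \<in> ?W" for w
      using weights[OF n \<omega>] that by (auto simp: is_arg_min_linorder)
    have what_mem: "what n \<omega> \<in> ?W"
      using weights[OF n \<omega>] by (simp add: is_arg_min_def)
    show ?thesis
    proof (rule argmin_ratio_bound[where h = "KLstar n" and g = "CV n \<omega>" and a = a and e = "err K * q"])
      show "bdd_below (KLstar n ` ?W)"
        using KLstar_nonneg by (intro bdd_belowI2[where m = 0])
    qed (use KL_close CV_close what what_mem \<tau> \<xi>_pos err_le in \<open>auto simp: \<xi> q_def\<close>)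
  qed

  \<comment> \<open>Passage to the limit\<close>
  show ?thesis
  proof (rule tendsto_prob_bounded_in_prob[OF Z])
    show "\<forall>\<^sub>F n in along N. finite_measure (M n)"
      by (rule eventually_mono[OF eventually_along_mem]) (rule prob_space.axioms(1)[OF prob])
    fix K \<epsilon> :: real assume \<epsilon>: "\<epsilon> > 0"
    \<comment> \<open>The cap \<open>1 / 2\<close> is what \<open>argmin_ratio_bound\<close> allows,
      and \<open>\<epsilon> / 8\<close> compensates its factor 8.\<close>
    define \<tau> where "\<tau> = min (1 / 2) (\<epsilon> / 8)"
    have \<tau>: "0 < \<tau>" "\<tau> \<le> 1 / 2" "8 * \<tau> \<le> \<epsilon>" using \<epsilon> by (auto simp: \<tau>_def)
    have sqrt_top: "filterlim (\<lambda>n. sqrt (real n)) at_top (along N)"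
      using filterlim_compose[OF sqrt_at_top filterlim_real_sequentially] along_le_sequentially
      by (rule filterlim_mono[OF _ order_refl])
    have "\<forall>\<^sub>F n in along N. max K (L * K / \<delta>) \<le> sqrt (real n)"
      using sqrt_top by (simp only: filterlim_at_top)
    \<comment> \<open>The squared form of the requirement that \<open>err K * sqrt (real n)\<close>
      be at most \<open>\<tau> * \<xi> n\<close>. As \<open>K\<close> is arbitrary,
      \<open>err K\<close> may vanish or be negative, hence the denominator
      \<open>\<bar>err K\<bar> + 1\<close>.\<close>
    moreover have "\<forall>\<^sub>F n in along N. real n / (\<xi> n)\<^sup>2 < (\<tau> / (\<bar>err K\<bar> + 1))\<^sup>2"
      using cond_f(2) \<tau> by (intro order_tendstoD(2)) auto
    ultimately show "\<forall>\<^sub>F n in along N. \<forall>\<omega>\<in>space (M n). \<bar>Z n \<omega>\<bar> \<le> K \<longrightarrow>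
        \<bar>KL n \<omega> (what n \<omega>) / (INF w\<in>?W. KL n \<omega> w) - 1\<bar> \<le> \<epsilon>"
      using eventually_along_mem cond_f(1)
    proof eventually_elim
      case (elim n)
      show ?case
      proof (intro ballI impI)
        fix \<omega> assume \<omega>: "\<omega> \<in> space (M n)" "\<bar>Z n \<omega>\<bar> \<le> K"
        have "(sqrt (real n) / \<xi> n)\<^sup>2 < (\<tau> / (\<bar>err K\<bar> + 1))\<^sup>2"
          using elim(2) by (simp add: power_divide)
        then have "sqrt (real n) / \<xi> n < \<tau> / (\<bar>err K\<bar> + 1)"
          by (rule power_less_imp_less_base) (use \<tau> in auto)
        then have "(\<bar>err K\<bar> + 1) * sqrt (real n) < \<tau> * \<xi> n"
          using elim(4) by (simp add: field_simps)
        moreover have "err K * sqrt (real n) \<le> (\<bar>err K\<bar> + 1) * sqrt (real n)"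
          by (intro mult_right_mono) auto
        ultimately have "err K * sqrt (real n) \<le> \<tau> * \<xi> n" by linarith
        moreover have "K \<le> sqrt (real n)" "L * K \<le> \<delta> * sqrt (real n)"
          using elim(1) \<delta>(1) by (auto simp: pos_divide_le_eq mult.commute)
        ultimately have "\<bar>KL n \<omega> (what n \<omega>) / (INF w\<in>?W. KL n \<omega> w) - 1\<bar> \<le> 8 * \<tau>"
          using core[OF elim(3) \<omega>] \<tau> elim(4) by simp
        then show "\<bar>KL n \<omega> (what n \<omega>) / (INF w\<in>?W. KL n \<omega> w) - 1\<bar> \<le> \<epsilon>"
          using \<tau>(3) by linarith
      qed
    qed
  qed
qed

end
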